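(* Let $a,b,n$ be positive integers such that $a\equiv b\pmod 2$, $a<b$, $na\equiv 0\pmod 2$ and $n\geq 3(b+1)(a+b)$. Let $G$ be a connected finite simple graph of order $n$ with minimum degree $\delta(G)\geq \frac{b^2-b}{a}$ (an inequality of real numbers). Suppose that $$\max\{d_G(u),d_G(v)\}\geq \frac{bn}{a+b}$$ for each pair of distinct nonadjacent vertices $u$ and $v$ in $V(G)$. Then $G$ has all $(a,b)$-parity factors.
   Context: All graphs are finite and simple. For a graph $G$ with vertex set $V(G)$ and edge set $E(G)$, the order of $G$ is $|V(G)|$, $d_G(x)$ denotes the degree of the vertex $x$ in $G$, and $\delta(G)$ is the minimum degree of $G$. A spanning subgraph of $G$ is a graph $F$ with $V(F)=V(G)$ and $E(F)\subseteq E(G)$. For a function $h:V(G)\to\mathbb{N}$ (non-negative integer valued), an $h$-factor of $G$ is a spanning subgraph $F$ of $G$ with $d_F(v)=h(v)$ for all $v\in V(G)$. For integers $a\leq b$ with $a\equiv b\pmod 2$, the graph $G$ (with $a|V(G)|$ even) is said to have all $(a,b)$-parity factors if $G$ has an $h$-factor for every integer-valued function $h$ on $V(G)$ with $a\leq h(v)\leq b$ and $h(v)\equiv a\pmod 2$ for all $v\in V(G)$. *)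

theory Defs
  imports Complex_Main "HOL-Number_Theory.Cong" "Graph_Theory.Digraph_Component"
begin

text \<open>
  Finite simple graphs are the locale \<^locale>\<open>graph\<close>: finite loopless digraphs without parallel
  arcs whose arc relation is symmetric. An undirected edge is thus a pair of opposite arcs, and the
  degree of a vertex is its out-degree.
\<close>

definition vertex_degree :: "('a, 'b) pre_digraph \<Rightarrow> 'a \<Rightarrow> nat" where
  "vertex_degree G v = out_degree G v"

text \<open>Meaningful only if \<open>G\<close> is finite and has a vertex.\<close>

definition min_degree :: "('a, 'b) pre_digraph \<Rightarrow> nat" where
  "min_degree G = Min (vertex_degree G ` verts G)"

text \<open>
  The condition \<^term>\<open>graph F\<close> makes the arc set of \<open>F\<close> symmetric, so that \<open>F\<close> arises from a
  subset of the undirected edges of \<open>G\<close>; \<^const>\<open>spanning\<close> alone allows any subset of the arcs.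
\<close>

definition is_factor :: "('a, 'b) pre_digraph \<Rightarrow> ('a \<Rightarrow> nat) \<Rightarrow> ('a, 'b) pre_digraph \<Rightarrow> bool" where
  "is_factor G h F \<longleftrightarrow> graph F \<and> spanning F G \<and> (\<forall>v\<in>verts G. vertex_degree F v = h v)"

definition has_all_parity_factors :: "nat \<Rightarrow> nat \<Rightarrow> ('a, 'b) pre_digraph \<Rightarrow> bool" where
  "has_all_parity_factors a b G \<longleftrightarrow>
     (\<forall>h. (\<forall>v\<in>verts G. a \<le> h v \<and> h v \<le> b \<and> [h v = a] (mod 2)) \<longrightarrow> (\<exists>F. is_factor G h F))"

end

theory Submission
  imports Defs
begin

text \<open>
  The degree sequences of the subgraphs of a graph satisfy an exchange axiom, proved with an
  alternating trail. It yields the deficiency form of Tutte's \<open>f\<close>-factor theorem by induction on the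
  number of vertices. If some vertex \<open>v\<close> exceeds \<open>h v\<close> in an optimal subgraph and never falls below,
  convexity shows that deleting \<open>v\<close> raises the deviation by \<open>h v\<close>, so \<open>v\<close> can join \<open>S\<close>;
  complementation treats the vertices that join \<open>T\<close>. If no such vertex is left, Gallai's argument
  shows that an optimal subgraph deviates at no more than one vertex of each component, by one.

  For the degree condition, let \<open>p = n / (a + b)\<close>. The vertices of degree less than \<open>b p\<close> form a
  clique, hence all but one component of \<open>G - S - T\<close> are large, and the vertices of \<open>T\<close> are either of
  large degree or form a clique. Counting then refutes every barrier: first \<open>\<bar>S\<bar>\<close> is well below
  \<open>b p\<close>, next there are at most two components, and then the minimum degree settles the rest.
\<close>

section \<open>Degree sequences and the exchange axiom\<close>

text \<open>Integer valued because exchanges subtract freely and the induction for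
  \<open>ex_barrier\<close> lowers prescribed degrees, possibly below zero.\<close>

definition edge_deg :: "'a set set \<Rightarrow> 'a \<Rightarrow> int" where
  "edge_deg F v = int (card {e \<in> F. v \<in> e})"

definition degree_seqs :: "'a set set \<Rightarrow> ('a \<Rightarrow> int) set" where
  "degree_seqs E = edge_deg ` Pow E"

definition deviation :: "'a set \<Rightarrow> ('a \<Rightarrow> int) \<Rightarrow> ('a \<Rightarrow> int) \<Rightarrow> int" where
  "deviation V h x = (\<Sum>v\<in>V. \<bar>x v - h v\<bar>)"

lemma degree_seqsI: "F \<subseteq> E \<Longrightarrow> edge_deg F = x \<Longrightarrow> x \<in> degree_seqs E"
  by (auto simp: degree_seqs_def)

lemma degree_seqs_mono: "E' \<subseteq> E \<Longrightarrow> degree_seqs E' \<subseteq> degree_seqs E"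
  by (auto simp: degree_seqs_def)

lemma edge_deg_insert:
  assumes "finite F" "{u, v} \<notin> F" "u \<noteq> v"
  shows "edge_deg (insert {u, v} F) = (edge_deg F)(u := edge_deg F u + 1, v := edge_deg F v + 1)"
proof
  fix w
  have "{e \<in> insert {u, v} F. w \<in> e} =
      (if w \<in> {u, v} then insert {u, v} {e \<in> F. w \<in> e} else {e \<in> F. w \<in> e})"
    by auto
  then show "edge_deg (insert {u, v} F) w =
      ((edge_deg F)(u := edge_deg F u + 1, v := edge_deg F v + 1)) w"
    using assms by (auto simp: edge_deg_def)
qed

lemma edge_deg_remove:
  assumes "finite F" "{u, v} \<in> F" "u \<noteq> v"
  shows "edge_deg (F - {{u, v}}) = (edge_deg F)(u := edge_deg F u - 1, v := edge_deg F v - 1)"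
proof -
  have "insert {u, v} (F - {{u, v}}) = F" using assms by blast
  then show ?thesis
    using edge_deg_insert[of "F - {{u, v}}" u v] assms by (simp add: fun_eq_iff)
qed

lemma edge_deg_Diff:
  assumes "finite E" "F \<subseteq> E"
  shows "edge_deg (E - F) v = edge_deg E v - edge_deg F v"
proof -
  have "{e \<in> E - F. v \<in> e} = {e \<in> E. v \<in> e} - {e \<in> F. v \<in> e}" by auto
  moreover have "{e \<in> F. v \<in> e} \<subseteq> {e \<in> E. v \<in> e}" using assms by auto
  moreover have "finite {e \<in> E. v \<in> e}" using assms by simp
  ultimately show ?thesis
    by (simp add: edge_deg_def card_Diff_subset finite_subset of_nat_diff card_mono)
qed

lemma deviation_nonneg: "0 \<le> deviation V h x"
  by (simp add: deviation_def sum_nonneg)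

lemma deviation_upd:
  assumes "finite V" "u \<in> V"
  shows "deviation V h (x(u := c)) = deviation V h x - \<bar>x u - h u\<bar> + \<bar>c - h u\<bar>"
proof -
  have "(\<Sum>v\<in>V - {u}. \<bar>(x(u := c)) v - h v\<bar>) = (\<Sum>v\<in>V - {u}. \<bar>x v - h v\<bar>)"
    by (rule sum.cong) auto
  then show ?thesis
    using assms by (simp add: deviation_def sum.remove[of V u])
qed

locale set_graph =
  fixes V :: "'a set" and E :: "'a set set"
  assumes finite_V: "finite V"
    and edgeE: "e \<in> E \<Longrightarrow> \<exists>u v. u \<in> V \<and> v \<in> V \<and> u \<noteq> v \<and> e = {u, v}"
begin

lemma finite_E: "finite E"
  by (rule finite_subset[of _ "Pow V"]) (use edgeE finite_V in auto)

lemma finite_sub: "F \<subseteq> E \<Longrightarrow> finite F"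
  using finite_E finite_subset by blast

lemma edgeD: "{u, v} \<in> E \<Longrightarrow> u \<in> V \<and> v \<in> V \<and> u \<noteq> v"
  using edgeE[of "{u, v}"] by (auto simp: doubleton_eq_iff)

lemma other_endE:
  assumes "e \<in> E" "v \<in> e"
  obtains w where "w \<in> V" "w \<noteq> v" "e = {v, w}"
  using edgeE[OF assms(1)] assms(2) by (metis insertE insert_commute singletonD)

lemma set_graph_sub: "E' \<subseteq> E \<Longrightarrow> set_graph V E'"
  using finite_V edgeE by unfold_locales auto

lemma edge_deg_outside: "F \<subseteq> E \<Longrightarrow> v \<notin> V \<Longrightarrow> edge_deg F v = 0"
proof -
  assume "F \<subseteq> E" "v \<notin> V"
  then have "{e \<in> F. v \<in> e} = {}" using edgeE by blast
  then show ?thesis unfolding edge_deg_def by (simp only: card.empty of_nat_0)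
qed

lemma degree_seqs_outside: "x \<in> degree_seqs E \<Longrightarrow> v \<notin> V \<Longrightarrow> x v = 0"
  using edge_deg_outside by (auto simp: degree_seqs_def)

lemma obtain_edge_less:
  assumes "A \<subseteq> E" "B \<subseteq> E" "edge_deg A w < edge_deg B w"
  obtains z where "{w, z} \<in> B" "{w, z} \<notin> A" "w \<noteq> z"
proof -
  have "\<not> {e \<in> B. w \<in> e} \<subseteq> {e \<in> A. w \<in> e}"
    using assms card_mono[of "{e \<in> A. w \<in> e}" "{e \<in> B. w \<in> e}"] finite_sub[of A]
    by (auto simp: edge_deg_def)
  then obtain e where e: "e \<in> B" "w \<in> e" "e \<notin> A" by auto
  moreover obtain p q where "e = {p, q}" "p \<noteq> q" using edgeE[of e] e assms by auto
  ultimately obtain z where "e = {w, z}" "w \<noteq> z" by (cases "w = p") auto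
  with e that[of z] show ?thesis by simp
qed

text \<open>
  An alternating trail started at \<open>u\<close> has its pending end at \<open>w\<close>; \<open>P\<close> and \<open>Q\<close> are the edges of
  the two original subgraphs that it has not used yet. As long as the end is not a step from \<open>x\<close>
  towards \<open>y\<close>, the last assumption provides an unused edge at \<open>w\<close>.
\<close>

lemma exchange_trail:
  assumes "A \<subseteq> E" "B \<subseteq> E" "\<sigma> \<in> {1, -1}" "P \<subseteq> A - B" "Q \<subseteq> B - A"
    and "edge_deg A = x(w := x w + \<sigma>)" "edge_deg B = y'(w := y' w - \<sigma>)"
    and "\<And>v. edge_deg P v - edge_deg Q v = x v - y v + (if v = w then \<sigma> else 0)"
  shows "\<exists>z. \<exists>\<tau>\<in>{1, -1}. \<tau> * (y z - x z) > 0 \<and>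
    x(z := x z + \<tau>) \<in> degree_seqs E \<and> y'(z := y' z - \<tau>) \<in> degree_seqs E"
  using assms
proof (induction "card P + card Q" arbitrary: A B P Q w \<sigma> rule: less_induct)
  case less
  have sub: "P \<subseteq> E" "Q \<subseteq> E" using less.prems by auto
  have fin: "finite A" "finite B" "finite P" "finite Q"
    using less.prems(1,2) sub finite_sub by auto
  show ?case
  proof (cases "\<sigma> * (y w - x w) > 0")
    case True
    then show ?thesis
      using less.prems by (intro exI[of _ w] bexI[of _ \<sigma>]) (auto intro: degree_seqsI)
  next
    case False
    show ?thesis
    proof (cases "\<sigma> = 1")
      case True
      then have "edge_deg Q w < edge_deg P w"
        using False less.prems(8)[of w] by auto
      then obtain z where z: "{w, z} \<in> P" "{w, z} \<notin> Q" "w \<noteq> z"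
        using obtain_edge_less sub by metis
      then have zAB: "{w, z} \<in> A" "{w, z} \<notin> B" using less.prems by auto
      show ?thesis
      proof (rule less.hyps[of "P - {{w,z}}" Q "A - {{w,z}}" "insert {w,z} B" "-1" z])
        show "card (P - {{w,z}}) + card Q < card P + card Q"
          using z fin card_Diff1_less by (metis add_less_cancel_right)
        show "edge_deg (A - {{w,z}}) = x(z := x z + - 1)"
          using z zAB fin True less.prems(6) by (simp add: edge_deg_remove fun_eq_iff)
        show "edge_deg (insert {w,z} B) = y'(z := y' z - - 1)"
          using z zAB fin True less.prems(7) by (simp add: edge_deg_insert fun_eq_iff)
        show "edge_deg (P - {{w,z}}) v - edge_deg Q v = x v - y v + (if v = z then -1 else 0)" for v
          using z fin True less.prems(8)[of v] by (auto simp: edge_deg_remove)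
      qed (use less.prems zAB in auto)
    next
      case F: False
      then have s: "\<sigma> = -1" using less.prems by auto
      then have "edge_deg P w < edge_deg Q w"
        using False less.prems(8)[of w] by auto
      then obtain z where z: "{w, z} \<in> Q" "{w, z} \<notin> P" "w \<noteq> z"
        using obtain_edge_less sub by metis
      then have zAB: "{w, z} \<in> B" "{w, z} \<notin> A" using less.prems by auto
      show ?thesis
      proof (rule less.hyps[of P "Q - {{w,z}}" "insert {w,z} A" "B - {{w,z}}" 1 z])
        show "card P + card (Q - {{w,z}}) < card P + card Q"
          using z fin card_Diff1_less by (metis add_less_cancel_left)
        show "edge_deg (B - {{w,z}}) = y'(z := y' z - 1)"
          using z zAB fin s less.prems(7) by (simp add: edge_deg_remove fun_eq_iff)
        show "edge_deg (insert {w,z} A) = x(z := x z + 1)"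
          using z zAB fin s less.prems(6) by (simp add: edge_deg_insert fun_eq_iff)
        show "edge_deg P v - edge_deg (Q - {{w,z}}) v = x v - y v + (if v = z then 1 else 0)" for v
          using z fin s less.prems(8)[of v] by (auto simp: edge_deg_remove)
      qed (use less.prems zAB in auto)
    qed
  qed
qed

text \<open>The two-step axiom of a constant-parity jump system.\<close>

lemma exchange:
  assumes "x \<in> degree_seqs E" "y \<in> degree_seqs E" "x u < y u"
  obtains
    (same) "x u + 2 \<le> y u" "x(u := x u + 2) \<in> degree_seqs E" "y(u := y u - 2) \<in> degree_seqs E"
  | (other) z \<sigma> where "z \<noteq> u" "z \<in> V" "\<sigma> \<in> {1, -1}" "\<sigma> * (y z - x z) > 0"
      "x(u := x u + 1, z := x z + \<sigma>) \<in> degree_seqs E"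
      "y(u := y u - 1, z := y z - \<sigma>) \<in> degree_seqs E"
proof -
  obtain A B where AB: "A \<subseteq> E" "B \<subseteq> E" "x = edge_deg A" "y = edge_deg B"
    using assms by (auto simp: degree_seqs_def)
  then obtain w where w: "{u, w} \<in> B" "{u, w} \<notin> A" "u \<noteq> w"
    using obtain_edge_less[of A B u] assms by auto
  let ?x = "x(u := x u + 1)" and ?y = "y(u := y u - 1)"
  have fin: "finite A" "finite B" using AB finite_sub by auto
  have diff: "edge_deg (A - B) v - edge_deg (B - A) v = x v - y v" for v
  proof -
    have "edge_deg (A - B) v = edge_deg A v - edge_deg (A \<inter> B) v"
      using edge_deg_Diff[of A "A \<inter> B" v] fin by (simp add: Diff_Int)
    moreover have "edge_deg (B - A) v = edge_deg B v - edge_deg (A \<inter> B) v"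
      using edge_deg_Diff[of B "A \<inter> B" v] fin by (simp add: Diff_Int)
    ultimately show ?thesis using AB by simp
  qed
  have "\<exists>z. \<exists>\<tau>\<in>{1, -1}. \<tau> * (y z - ?x z) > 0 \<and>
    ?x(z := ?x z + \<tau>) \<in> degree_seqs E \<and> ?y(z := ?y z - \<tau>) \<in> degree_seqs E"
  \<comment> \<open>The edge \<open>{u,w}\<close> makes the step at \<open>u\<close> and is spent,
    hence absent from \<open>Q\<close>; the trail starts at \<open>w\<close> with a surplus of one.
    Directions are measured against the fixed \<open>y\<close>, while \<open>?y\<close> is the
    sequence that moves.\<close>
  proof (rule exchange_trail[of "insert {u,w} A" "B - {{u,w}}" 1 "A - B" "(B - A) - {{u,w}}" ?x w ?y y])
    show "edge_deg (insert {u,w} A) = ?x(w := ?x w + 1)"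
      using w AB finite_sub by (simp add: edge_deg_insert)
    show "edge_deg (B - {{u,w}}) = ?y(w := ?y w - 1)"
      using w AB finite_sub by (simp add: edge_deg_remove)
    show "edge_deg (A - B) v - edge_deg (B - A - {{u,w}}) v = ?x v - y v + (if v = w then 1 else 0)" for v
      using w fin diff[of v] by (auto simp: edge_deg_remove)
  qed (use AB w in auto)
  then obtain z \<tau> where z: "\<tau> \<in> {1, -1}" "\<tau> * (y z - ?x z) > 0"
    "?x(z := ?x z + \<tau>) \<in> degree_seqs E" "?y(z := ?y z - \<tau>) \<in> degree_seqs E"
    by blast
  show ?thesis
  proof (cases "z = u")
    case True
    \<comment> \<open>Since \<open>x u < y u\<close>, a step down at \<open>u\<close> would not go
      towards \<open>y\<close>; the trail returns with a second step up.\<close>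
    then have "\<tau> = 1" using z assms by auto
    with True z show ?thesis by (intro same) (auto simp: add.commute)
  next
    case False
    moreover have "z \<in> V"
    proof (rule ccontr)
      assume "z \<notin> V"
      then have "x z = 0" "y z = 0" using assms degree_seqs_outside by auto
      with z False show False by auto
    qed
    ultimately show ?thesis using z by (intro other[of z \<tau>]) auto
  qed
qed

section \<open>Optimal degree sequences\<close>

definition optimal :: "('a \<Rightarrow> int) \<Rightarrow> ('a \<Rightarrow> int) \<Rightarrow> bool" where
  "optimal h x \<longleftrightarrow> x \<in> degree_seqs E \<and> (\<forall>y\<in>degree_seqs E. deviation V h x \<le> deviation V h y)"

lemma optimalD:
  "optimal h x \<Longrightarrow> x \<in> degree_seqs E"
  "optimal h x \<Longrightarrow> y \<in> degree_seqs E \<Longrightarrow> deviation V h x \<le> deviation V h y"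
  by (auto simp: optimal_def)

lemma optimal_if_le:
  "optimal h x \<Longrightarrow> y \<in> degree_seqs E \<Longrightarrow> deviation V h y \<le> deviation V h x \<Longrightarrow> optimal h y"
  by (force simp: optimal_def)

lemma ex_optimal: "\<exists>x. optimal h x"
proof -
  have "edge_deg {} \<in> degree_seqs E" by (auto intro: degree_seqsI)
  from ex_has_least_nat[of "\<lambda>x. x \<in> degree_seqs E", OF this, of "\<lambda>x. nat (deviation V h x)"]
  show ?thesis
    by (force simp: optimal_def nat_le_eq_zle deviation_nonneg)
qed

lemma in_V_if_less: "x \<in> degree_seqs E \<Longrightarrow> y \<in> degree_seqs E \<Longrightarrow> x u < y u \<Longrightarrow> u \<in> V"
  by (metis degree_seqs_outside less_irrefl)

lemma deviation_upd1: "u \<in> V \<Longrightarrow>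
    deviation V h (x(u := c)) = deviation V h x - \<bar>x u - h u\<bar> + \<bar>c - h u\<bar>"
  by (rule deviation_upd[OF finite_V])

lemma deviation_upd2: "u \<in> V \<Longrightarrow> z \<in> V \<Longrightarrow> z \<noteq> u \<Longrightarrow>
    deviation V h (x(u := c, z := d)) =
      deviation V h x - \<bar>x u - h u\<bar> + \<bar>c - h u\<bar> - \<bar>x z - h z\<bar> + \<bar>d - h z\<bar>"
  by (simp add: deviation_upd1)

text \<open>At \<open>z\<close> the two sequences move towards each other, so by convexity of the
  absolute value their joint deviation there does not grow; only the change at \<open>u\<close>
  remains.\<close>

lemma exchange_deviation:
  assumes "u \<in> V" "z \<in> V" "z \<noteq> u" "\<sigma> \<in> {1, -1}" "\<sigma> * (y z - x z) > 0"
  shows "deviation V h (x(u := x u + 1, z := x z + \<sigma>))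
      + deviation V h (y(u := y u - 1, z := y z - \<sigma>))
    \<le> deviation V h x + deviation V h y
      + \<bar>x u + 1 - h u\<bar> - \<bar>x u - h u\<bar> + \<bar>y u - 1 - h u\<bar> - \<bar>y u - h u\<bar>"
proof -
  have "\<bar>x z + \<sigma> - h z\<bar> + \<bar>y z - \<sigma> - h z\<bar> \<le> \<bar>x z - h z\<bar> + \<bar>y z - h z\<bar>"
    using assms(4,5) by (elim insertE) auto
  then show ?thesis using assms(1-3) by (simp add: deviation_upd2)
qed

text \<open>
  Two optimal sequences on opposite sides of \<open>h u\<close> admit no exchange at \<open>u\<close> and a second vertex,
  as it would decrease the sum of the deviations.
\<close>

lemma flip:
  assumes "optimal h x" "optimal h y" "x u < h u" "h u < y u"
  shows "x u = h u - 1" "y u = h u + 1" "optimal h (x(u := h u + 1))" "optimal h (y(u := h u - 1))"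
proof -
  note J = optimalD(1)[OF assms(1)] optimalD(1)[OF assms(2)]
  have less: "x u < y u" using assms by linarith
  have u: "u \<in> V" using in_V_if_less[OF J less] .
  have "x u = h u - 1 \<and> y u = h u + 1 \<and> optimal h (x(u := h u + 1)) \<and> optimal h (y(u := h u - 1))"
  proof (rule exchange[OF J less])
    assume s: "x u + 2 \<le> y u" "x(u := x u + 2) \<in> degree_seqs E" "y(u := y u - 2) \<in> degree_seqs E"
    \<comment> \<open>A step of two from below \<open>h u\<close> fails to improve an optimal
      sequence only if it lands on \<open>h u + 1\<close>.\<close>
    have 1: "x u = h u - 1"
      using optimalD(2)[OF assms(1) s(2)] assms(3) u by (simp add: deviation_upd1)
    have 2: "y u = h u + 1"
      using optimalD(2)[OF assms(2) s(3)] assms(4) u by (simp add: deviation_upd1)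
    show ?thesis
      using optimal_if_le[OF assms(1) s(2)] optimal_if_le[OF assms(2) s(3)] 1 2 u
      by (simp add: deviation_upd1 add.commute)
  next
    fix z \<sigma>
    assume s: "z \<noteq> u" "z \<in> V" "\<sigma> \<in> {1, - 1}" "0 < \<sigma> * (y z - x z)"
      "x(u := x u + 1, z := x z + \<sigma>) \<in> degree_seqs E"
      "y(u := y u - 1, z := y z - \<sigma>) \<in> degree_seqs E"
    show ?thesis
      using exchange_deviation[where x=x and y=y and h=h, OF u s(2,1,3,4)] optimalD(2)[OF assms(1) s(5)]
        optimalD(2)[OF assms(2) s(6)] assms(3,4) by simp
  qed
  then show "x u = h u - 1" "y u = h u + 1" "optimal h (x(u := h u + 1))" "optimal h (y(u := h u - 1))"
    by auto
qed

text \<open>An exchange at \<open>v\<close> with \<open>y\<close> brings both sequences closer to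
  \<open>h v\<close> and lowers the joint deviation by at least two. Optimality of \<open>y\<close>
  puts the whole gain on the side of \<open>x\<close>, and induction raises \<open>x v\<close> to
  \<open>h v\<close>. A double step is impossible, as it would produce an optimal sequence below
  \<open>h v\<close>.\<close>

lemma deviation_ge_if_never_below:
  assumes y: "optimal h y" "h v < y v"
    and never: "\<And>x. optimal h x \<Longrightarrow> h v \<le> x v"
    and x: "x \<in> degree_seqs E" "x v < h v"
  shows "deviation V h y + 2 * (h v - x v) \<le> deviation V h x"
  using x
proof (induction "nat (h v - x v)" arbitrary: x rule: less_induct)
  case less
  note J = less.prems(1) optimalD(1)[OF y(1)]
  have lt: "x v < y v" using less.prems y by linarith
  have v: "v \<in> V" using in_V_if_less[OF J lt] .
  show ?case
  proof (rule exchange[OF J lt])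
    assume s: "x v + 2 \<le> y v" "x(v := x v + 2) \<in> degree_seqs E" "y(v := y v - 2) \<in> degree_seqs E"
    have "y v = h v + 1"
      using optimalD(2)[OF y(1) s(3)] y(2) v by (simp add: deviation_upd1)
    with optimal_if_le[OF y(1) s(3)] v have "optimal h (y(v := y v - 2))"
      by (simp add: deviation_upd1)
    from never[OF this] show ?thesis using \<open>y v = h v + 1\<close> by simp
  next
    fix z \<sigma>
    assume s: "z \<noteq> v" "z \<in> V" "\<sigma> \<in> {1, - 1}" "0 < \<sigma> * (y z - x z)"
      "x(v := x v + 1, z := x z + \<sigma>) \<in> degree_seqs E"
      "y(v := y v - 1, z := y z - \<sigma>) \<in> degree_seqs E"
    let ?x = "x(v := x v + 1, z := x z + \<sigma>)"
    have le: "deviation V h ?x + 2 \<le> deviation V h x"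
      using exchange_deviation[where x=x and y=y and h=h, OF v s(2,1,3,4)] optimalD(2)[OF y(1) s(6)]
        y(2) less.prems(2) by simp
    have xv: "?x v = x v + 1" using s(1) by simp
    show ?thesis
    proof (cases "x v + 1 < h v")
      case True
      then have "deviation V h y + 2 * (h v - ?x v) \<le> deviation V h ?x"
        using less.hyps[of ?x] s(5) xv by auto
      then show ?thesis using le xv by simp
    next
      case False
      then show ?thesis using optimalD(2)[OF y(1) s(5)] le less.prems(2) by simp
    qed
  qed
qed

text \<open>Without edges at \<open>v\<close> the degree there is 0, so \<open>v\<close> itself
  contributes \<open>\<bar>h v\<bar>\<close>. For \<open>h v > 0\<close> the previous bound gives an
  increase by \<open>2 * h v\<close>, half of which is that contribution; otherwise optimality of
  \<open>y\<close> suffices.\<close>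

lemma delete_vertex_above:
  assumes y: "optimal h y" "h v < y v"
    and never: "\<And>x. optimal h x \<Longrightarrow> h v \<le> x v"
    and v: "v \<in> V" and F: "F \<subseteq> {e \<in> E. v \<notin> e}"
  shows "deviation V h y + h v \<le> deviation (V - {v}) h (edge_deg F)"
proof -
  have J: "edge_deg F \<in> degree_seqs E" using F by (auto intro: degree_seqsI)
  have "{e \<in> F. v \<in> e} = {}" using F by auto
  then have 0: "edge_deg F v = 0" unfolding edge_deg_def by (simp only: card.empty of_nat_0)
  have "deviation V h (edge_deg F) = \<bar>h v\<bar> + deviation (V - {v}) h (edge_deg F)"
    using 0 finite_V v by (simp add: deviation_def sum.remove[of V v])
  moreover have "deviation V h y \<le> deviation V h (edge_deg F)" using optimalD(2)[OF y(1) J] .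
  moreover have "deviation V h y + 2 * h v \<le> deviation V h (edge_deg F)" if "0 < h v"
    using deviation_ge_if_never_below[of h y v "edge_deg F"] y never J 0 that by simp
  ultimately show ?thesis by (cases "0 < h v") auto
qed

end

section \<open>Gallai's lemma\<close>

text \<open>
  No vertex lies always on one side of its prescribed degree. A vertex whose degree can deviate in
  some optimal sequence then plays the role of a vertex missed by some maximum matching in Gallai's
  lemma.
\<close>

locale balanced_graph = set_graph +
  fixes h :: "'a \<Rightarrow> int"
  assumes balanced: "u \<in> V \<Longrightarrow> (\<exists>x. optimal h x \<and> x u < h u) \<longleftrightarrow> (\<exists>x. optimal h x \<and> h u < x u)"
begin

text \<open>Balance provides an optimal sequence on the other side of \<open>h u\<close>, so
  \<open>flip\<close> applies: deviations are by one and can be reflected.\<close>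

lemma flip_up:
  assumes "optimal h x" "u \<in> V" "x u < h u"
  shows "x u = h u - 1" "optimal h (x(u := h u + 1))"
  using flip(1,3)[OF assms(1) _ assms(3)] balanced assms by blast+

lemma flip_down:
  assumes "optimal h x" "u \<in> V" "h u < x u"
  shows "x u = h u + 1" "optimal h (x(u := h u - 1))"
  using flip(2,4)[OF _ assms(1) _ assms(3)] balanced assms by blast+

text \<open>Inserting the edge mends one unit at \<open>u\<close> and spoils one at
  \<open>v\<close>, so the deviation does not grow.\<close>

lemma toggle_add:
  assumes x: "optimal h (edge_deg F)" and F: "F \<subseteq> E" "{u, v} \<in> E" "{u, v} \<notin> F"
    and u: "edge_deg F u < h u" and v: "h v \<le> edge_deg F v"
  shows "optimal h ((edge_deg F)(u := edge_deg F u + 1, v := edge_deg F v + 1))"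
proof (rule optimal_if_le[OF x])
  have uv: "u \<in> V" "v \<in> V" "v \<noteq> u" using edgeD F by auto
  have "edge_deg (insert {u, v} F) = (edge_deg F)(u := edge_deg F u + 1, v := edge_deg F v + 1)"
    using edge_deg_insert F finite_sub uv by metis
  then show "(edge_deg F)(u := edge_deg F u + 1, v := edge_deg F v + 1) \<in> degree_seqs E"
    using F by (intro degree_seqsI[of "insert {u, v} F"]) auto
  show "deviation V h ((edge_deg F)(u := edge_deg F u + 1, v := edge_deg F v + 1))
      \<le> deviation V h (edge_deg F)"
    using uv u v by (simp add: deviation_upd2)
qed

lemma toggle_remove:
  assumes x: "optimal h (edge_deg F)" and F: "F \<subseteq> E" "{u, v} \<in> F"
    and u: "h u < edge_deg F u" and v: "edge_deg F v \<le> h v"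
  shows "optimal h ((edge_deg F)(u := edge_deg F u - 1, v := edge_deg F v - 1))"
proof (rule optimal_if_le[OF x])
  have uv: "u \<in> V" "v \<in> V" "v \<noteq> u" using edgeD F by auto
  have "edge_deg (F - {{u, v}}) = (edge_deg F)(u := edge_deg F u - 1, v := edge_deg F v - 1)"
    using edge_deg_remove F finite_sub uv by metis
  then show "(edge_deg F)(u := edge_deg F u - 1, v := edge_deg F v - 1) \<in> degree_seqs E"
    using F by (intro degree_seqsI[of "F - {{u, v}}"]) auto
  show "deviation V h ((edge_deg F)(u := edge_deg F u - 1, v := edge_deg F v - 1))
      \<le> deviation V h (edge_deg F)"
    using uv u v by (simp add: deviation_upd2)
qed

text \<open>Reflect the deviations so that \<open>u\<close> is too high and \<open>v\<close> too
  low. Deleting or inserting the edge \<open>{u, v}\<close> keeps the sequence optimal, mends one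
  end and leaves the other off by two, which \<open>flip_up\<close> and \<open>flip_down\<close>
  forbid.\<close>

lemma adjacent_not_both_deviate:
  assumes "optimal h x" "{u, v} \<in> E" "x u \<noteq> h u"
  shows "x v = h v"
proof (rule ccontr)
  assume xv: "x v \<noteq> h v"
  have uv: "u \<in> V" "v \<in> V" "u \<noteq> v" using edgeD assms by blast+
  have "\<exists>y. optimal h y \<and> h u < y u \<and> y v \<noteq> h v"
  proof (cases "x u < h u")
    case True
    then show ?thesis
      using flip_up(2)[OF assms(1) uv(1) True] xv uv by (intro exI[of _ "x(u := h u + 1)"]) auto
  qed (use assms xv in force)
  then obtain y where y: "optimal h y" "h u < y u" "y v \<noteq> h v" by blast
  have "\<exists>y. optimal h y \<and> h u < y u \<and> y v < h v"
  proof (cases "h v < y v")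
    case True
    then show ?thesis
      using flip_down(2)[OF y(1) uv(2) True] y uv by (intro exI[of _ "y(v := h v - 1)"]) auto
  qed (use y in force)
  then obtain y where y: "optimal h y" "h u < y u" "y v < h v" by blast
  then obtain F where F: "F \<subseteq> E" "y = edge_deg F"
    using optimalD(1)[OF y(1)] by (auto simp: degree_seqs_def)
  show False
  proof (cases "{u, v} \<in> F")
    case True
    from toggle_remove[OF _ F(1) True] y F
    have "optimal h (y(u := y u - 1, v := y v - 1))" by auto
    from flip_up(1)[OF this, of v] flip_up(1)[OF y(1) uv(2) y(3)] uv show False by auto
  next
    case False
    then have "{v, u} \<in> E" "{v, u} \<notin> F" using assms by (auto simp: insert_commute)
    from toggle_add[OF _ F(1) this] y F
    have "optimal h (y(v := y v + 1, u := y u + 1))" by auto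
    from flip_down(1)[OF this, of u] flip_down(1)[OF y(1) uv(1) y(2)] uv show False by auto
  qed
qed

text \<open>Suppose all optimal sequences agree with \<open>h\<close> at \<open>v\<close>, and take
  \<open>x\<close> too low at \<open>u\<close>. Toggling \<open>{u, v}\<close> would move the
  deviation to \<open>v\<close>; so realisations of \<open>x\<close> contain this edge, while a
  realisation of the reflected sequence avoids it. An exchange in the graph without the edge
  contradicts this.\<close>

lemma deviating_neighbour:
  assumes x: "optimal h x" "x u \<noteq> h u" and e: "{u, v} \<in> E"
  shows "\<exists>y. optimal h y \<and> y v \<noteq> h v"
proof (rule ccontr)
  assume "\<not> ?thesis"
  then have fix_v: "y v = h v" if "optimal h y" for y using that by blast
  have uv: "u \<in> V" "v \<in> V" "u \<noteq> v" using edgeD e by auto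
  have "\<exists>x. optimal h x \<and> x u < h u"
    using x balanced uv(1) by (metis linorder_neqE_linordered_idom)
  then obtain x where x: "optimal h x" "x u < h u" by blast
  note xu = flip_up[OF x(1) uv(1) x(2)]
  have in_F: "{u, v} \<in> F" if F: "F \<subseteq> E" "edge_deg F = x" for F
  proof (rule ccontr)
    assume "{u, v} \<notin> F"
    from toggle_add[OF _ F(1) e this] x F fix_v[OF x(1)]
    have "optimal h (x(u := x u + 1, v := x v + 1))" by auto
    from fix_v[OF this] fix_v[OF x(1)] show False by simp
  qed
  from optimalD(1)[OF x(1)] obtain A where A: "A \<subseteq> E" "edge_deg A = x"
    by (auto simp: degree_seqs_def)
  from optimalD(1)[OF xu(2)] obtain B where B: "B \<subseteq> E" "edge_deg B = x(u := h u + 1)"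
    unfolding degree_seqs_def by force
  have nB: "{u, v} \<notin> B"
  proof
    assume uB: "{u, v} \<in> B"
    from toggle_remove[OF _ B(1) uB] xu B fix_v[OF x(1)] uv
    have "optimal h ((x(u := h u + 1))(u := h u, v := h v - 1))" by auto
    from fix_v[OF this] show False by simp
  qed
  let ?E = "E - {{u, v}}"
  interpret D: set_graph V ?E by (rule set_graph_sub) auto
  \<comment> \<open>The degrees of \<open>A\<close> without the edge: compared with the reflected
    sequence, three too low at \<open>u\<close> and one at \<open>v\<close>. An exchange from
    \<open>u\<close> thus either reaches \<open>h u\<close> with \<open>v\<close> off by one, or
    raises both by one and realises \<open>x\<close> without the edge.\<close>
  let ?y = "x(u := h u - 2, v := h v - 1)"
  have "edge_deg (A - {{u, v}}) = ?y"
    using edge_deg_remove[OF finite_sub[OF A(1)] in_F[OF A] uv(3)] A xu fix_v[OF x(1)] by simp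
  then have y: "?y \<in> degree_seqs ?E" using A by (intro degree_seqsI[of "A - {{u, v}}"]) auto
  have z: "x(u := h u + 1) \<in> degree_seqs ?E"
    using B nB by (intro degree_seqsI[of B]) auto
  have less: "?y u < (x(u := h u + 1)) u" using uv by simp
  show False
  proof (rule D.exchange[OF y z less])
    assume "?y(u := ?y u + 2) \<in> degree_seqs ?E"
    moreover have "?y(u := ?y u + 2) = x(u := h u, v := h v - 1)" using uv by (simp add: fun_eq_iff)
    ultimately have J: "x(u := h u, v := h v - 1) \<in> degree_seqs E"
      using degree_seqs_mono[of ?E E] by auto
    have "optimal h (x(u := h u, v := h v - 1))"
      by (rule optimal_if_le[OF x(1) J]) (use uv xu fix_v[OF x(1)] in \<open>simp add: deviation_upd2\<close>)
    from fix_v[OF this] show False by simp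
  next
    fix w \<sigma>
    assume w: "w \<noteq> u" "\<sigma> \<in> {1, - 1}" "0 < \<sigma> * ((x(u := h u + 1)) w - ?y w)"
      and J: "?y(u := ?y u + 1, w := ?y w + \<sigma>) \<in> degree_seqs ?E"
    have wv: "w = v" using w by (auto split: if_splits)
    then have "\<sigma> = 1" using w uv fix_v[OF x(1)] by auto
    then have "?y(u := ?y u + 1, w := ?y w + \<sigma>) = x"
      using wv uv xu fix_v[OF x(1)] by (simp add: fun_eq_iff)
    with J obtain C where "C \<subseteq> ?E" "edge_deg C = x" by (auto simp: degree_seqs_def)
    with in_F[of C] show False by auto
  qed
qed

definition adj :: "('a \<times> 'a) set" where
  "adj = {(u, v). {u, v} \<in> E}"

lemma adjD: "(u, v) \<in> adj \<Longrightarrow> {u, v} \<in> E"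
  by (simp add: adj_def)

text \<open>
  Exchanging \<open>x\<close>, which deviates at \<open>u\<close> and \<open>v\<close>, with an optimal sequence that deviates at the
  neighbour \<open>w\<close> of \<open>u\<close> moves the deviation from \<open>u\<close> to \<open>w\<close>, which is closer to \<open>v\<close>.
\<close>

lemma gallai:
  assumes "optimal h x" "(u, v) \<in> adj ^^ k" "u \<noteq> v" "x u \<noteq> h u"
  shows "x v = h v"
  using assms
proof (induction k arbitrary: u x)
  case 0
  then show ?case by simp
next
  case (Suc k)
  then obtain w where w: "(u, w) \<in> adj" "(w, v) \<in> adj ^^ k" by (metis relpow_Suc_E2)
  note uw = adjD[OF w(1)]
  show ?case
  proof (cases "w = v")
    case True
    then show ?thesis using adjacent_not_both_deviate uw Suc.prems by blast
  next
    case False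
    have u: "u \<in> V" and ne: "u \<noteq> w" using edgeD uw by blast+
    obtain y where y: "optimal h y" "y w \<noteq> h w"
      using deviating_neighbour[OF Suc.prems(1,4) uw] by blast
    have yu: "y u = h u"
      using adjacent_not_both_deviate[OF y(1), of w u] uw y(2) by (simp add: insert_commute)
    have xw: "x w = h w" using adjacent_not_both_deviate[OF Suc.prems(1) uw Suc.prems(4)] .
    show ?thesis
    proof (rule ccontr)
      assume xv: "x v \<noteq> h v"
      \<comment> \<open>Reflecting at \<open>u\<close>, if necessary, lets the exchange start
        upwards and changes neither \<open>w\<close> nor \<open>v\<close>.\<close>
      have "\<exists>x. optimal h x \<and> x u < h u \<and> x w = h w \<and> x v \<noteq> h v"
      proof (cases "x u < h u")
        case F: False
        then have "h u < x u" using Suc.prems by simp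
        from flip_down[OF Suc.prems(1) u this] show ?thesis
          using xw xv ne Suc.prems(3) by (intro exI[of _ "x(u := h u - 1)"]) auto
      qed (use Suc.prems xw xv in blast)
      then obtain x where x: "optimal h x" "x u < h u" "x w = h w" "x v \<noteq> h v" by blast
      have less: "x u < y u" using x yu by simp
      note J = optimalD(1)[OF x(1)] optimalD(1)[OF y(1)]
      show False
      proof (rule exchange[OF J less])
        assume "x u + 2 \<le> y u"
        then show False using flip_up(1)[OF x(1) u x(2)] yu by simp
      next
        fix z \<sigma>
        assume s: "z \<noteq> u" "z \<in> V" "\<sigma> \<in> {1, - 1}" "0 < \<sigma> * (y z - x z)"
          "x(u := x u + 1, z := x z + \<sigma>) \<in> degree_seqs E"
          "y(u := y u - 1, z := y z - \<sigma>) \<in> degree_seqs E"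
        let ?x = "x(u := x u + 1, z := x z + \<sigma>)" and ?y = "y(u := y u - 1, z := y z - \<sigma>)"
        have sum: "deviation V h ?x + deviation V h ?y \<le> deviation V h x + deviation V h y"
          using exchange_deviation[where x=x and y=y and h=h, OF u s(2,1,3,4)] x(2) yu by simp
        have "optimal h ?x"
          by (rule optimal_if_le[OF x(1) s(5)]) (use sum optimalD(2)[OF y(1) s(6)] in linarith)
        have "optimal h ?y"
          by (rule optimal_if_le[OF y(1) s(6)]) (use sum optimalD(2)[OF x(1) s(5)] in linarith)
        \<comment> \<open>\<open>?y\<close> deviates at \<open>u\<close>, hence not at its neighbour
          \<open>w\<close>; as \<open>y\<close> does, the second vertex of the exchange must be
          \<open>w\<close>.\<close>
        then have "?y w = h w"
          by (rule adjacent_not_both_deviate[OF _ uw]) (use s(1) yu in simp)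
        then have z: "z = w" using y(2) ne by (auto split: if_splits)
        then have "?x w \<noteq> h w" "?x v \<noteq> h v"
          using x s ne False Suc.prems(3) by auto
        with Suc.IH[OF \<open>optimal h ?x\<close> w(2) False] show False by blast
      qed
    qed
  qed
qed

end

section \<open>Tutte's theorem on factors\<close>

text \<open>The members of \<open>K\<close> are pairwise disjoint nonempty unions of components of
  the graph induced on \<open>W\<close>; they may leave part of \<open>W\<close> uncovered.\<close>

definition separated :: "'a set set \<Rightarrow> 'a set \<Rightarrow> 'a set set \<Rightarrow> bool" where
  "separated E W K \<longleftrightarrow>
    (\<forall>C\<in>K. C \<noteq> {} \<and> C \<subseteq> W \<and> (\<forall>x\<in>C. \<forall>y\<in>W. {x, y} \<in> E \<longrightarrow> y \<in> C)) \<and>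
    (\<forall>C\<in>K. \<forall>D\<in>K. C \<noteq> D \<longrightarrow> C \<inter> D = {})"

lemma separatedD:
  assumes "separated E W K" "C \<in> K"
  shows "C \<noteq> {}" "C \<subseteq> W" "x \<in> C \<Longrightarrow> y \<in> W \<Longrightarrow> {x, y} \<in> E \<Longrightarrow> y \<in> C"
    "D \<in> K \<Longrightarrow> C \<noteq> D \<Longrightarrow> C \<inter> D = {}"
proof -
  have *: "C \<noteq> {} \<and> C \<subseteq> W \<and> (\<forall>x\<in>C. \<forall>y\<in>W. {x, y} \<in> E \<longrightarrow> y \<in> C)"
    "\<forall>D\<in>K. C \<noteq> D \<longrightarrow> C \<inter> D = {}"
    using assms by (simp_all add: separated_def)
  show "C \<noteq> {}" "C \<subseteq> W" using * by simp_all
  show "y \<in> C" if "x \<in> C" "y \<in> W" "{x, y} \<in> E" using * that by simp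
  show "C \<inter> D = {}" if "D \<in> K" "C \<noteq> D" using * that by simp
qed

text \<open>Tutte's expression for the pair \<open>S\<close>, \<open>T\<close>: the sum over
  \<open>T\<close> counts degrees in \<open>G - S\<close>, and \<open>card K\<close> stands in for
  the number of odd components.\<close>

definition barrier_value ::
  "'a set \<Rightarrow> 'a set set \<Rightarrow> ('a \<Rightarrow> int) \<Rightarrow> 'a set \<Rightarrow> 'a set \<Rightarrow> 'a set set \<Rightarrow> int" where
  "barrier_value V E h S T K =
    sum h S - sum h T + (\<Sum>v\<in>T. int (card {w \<in> V - S. {v, w} \<in> E})) - int (card K)"

context balanced_graph
begin

lemma sym_adj: "(u, v) \<in> adj\<^sup>* \<Longrightarrow> (v, u) \<in> adj\<^sup>*"
proof -
  have "sym adj" by (auto simp: adj_def sym_def insert_commute)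
  then show "(u, v) \<in> adj\<^sup>* \<Longrightarrow> (v, u) \<in> adj\<^sup>*" by (meson sym_rtrancl symD)
qed

text \<open>By \<open>gallai\<close> the deviating vertices lie in distinct components, and each
  deviates by one. Their components form \<open>K\<close>.\<close>

lemma deviation_le_separated:
  assumes x: "optimal h x"
  shows "\<exists>K. separated E V K \<and> deviation V h x \<le> int (card K)"
proof -
  define D where "D = {v \<in> V. x v \<noteq> h v}"
  define K where "K = (\<lambda>v. {w. (v, w) \<in> adj\<^sup>*}) ` D"
  have in_V: "w \<in> V" if "(v, w) \<in> adj\<^sup>*" "v \<in> V" for v w
    using that by (induction rule: rtrancl_induct) (use edgeD in \<open>auto simp: adj_def\<close>)
  have "separated E V K"
    unfolding separated_def
  proof (intro conjI ballI impI)
    fix C assume "C \<in> K"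
    then obtain v where v: "v \<in> V" "C = {w. (v, w) \<in> adj\<^sup>*}" by (auto simp: K_def D_def)
    then show "C \<noteq> {}" "C \<subseteq> V" using in_V by auto
    fix a b assume "a \<in> C" "b \<in> V" "{a, b} \<in> E"
    then show "b \<in> C" using v by (auto simp: adj_def intro: rtrancl_into_rtrancl)
  next
    fix C C' assume "C \<in> K" "C' \<in> K" "C \<noteq> C'"
    then obtain v v' where "C = {w. (v, w) \<in> adj\<^sup>*}" "C' = {w. (v', w) \<in> adj\<^sup>*}"
      by (auto simp: K_def)
    then show "C \<inter> C' = {}" using \<open>C \<noteq> C'\<close> sym_adj by (blast intro: rtrancl_trans)
  qed
  moreover have "inj_on (\<lambda>v. {w. (v, w) \<in> adj\<^sup>*}) D"
  proof (rule inj_onI)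
    fix u v assume uv: "u \<in> D" "v \<in> D" "{w. (u, w) \<in> adj\<^sup>*} = {w. (v, w) \<in> adj\<^sup>*}"
    then have "(u, v) \<in> adj\<^sup>*" by auto
    then obtain k where "(u, v) \<in> adj ^^ k" using rtrancl_power by blast
    then show "u = v" using gallai[OF x] uv by (auto simp: D_def)
  qed
  then have "card K = card D" by (simp add: K_def card_image)
  moreover have "deviation V h x \<le> int (card D)"
  proof -
    have "\<bar>x v - h v\<bar> \<le> (if v \<in> D then 1 else 0)" if "v \<in> V" for v
      using that flip_up(1)[OF x that] flip_down(1)[OF x that] by (force simp: D_def)
    then have "deviation V h x \<le> (\<Sum>v\<in>V. if v \<in> D then 1 else 0)"
      unfolding deviation_def by (rule sum_mono)
    also have "\<dots> = int (card D)"
      using finite_V by (simp add: sum.If_cases D_def Int_def)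
    finally show ?thesis .
  qed
  ultimately show ?thesis by auto
qed

end

section \<open>Complementation and vertex deletion\<close>

context set_graph
begin

text \<open>Passing to \<open>E - F\<close> and \<open>edge_deg E - h\<close> swaps the two sides of a barrier.\<close>

lemma complement_degree_seqs:
  assumes "x \<in> degree_seqs E"
  shows "(\<lambda>v. edge_deg E v - x v) \<in> degree_seqs E"
proof -
  obtain F where "F \<subseteq> E" "x = edge_deg F" using assms by (auto simp: degree_seqs_def)
  then show ?thesis using finite_E
    by (intro degree_seqsI[of "E - F"]) (auto simp: edge_deg_Diff)
qed

lemma complement_deviation:
  "deviation V (\<lambda>v. edge_deg E v - h v) (\<lambda>v. edge_deg E v - x v) = deviation V h x"
  unfolding deviation_def by (rule sum.cong) auto

lemma complement_optimal:
  assumes "optimal h x"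
  shows "optimal (\<lambda>v. edge_deg E v - h v) (\<lambda>v. edge_deg E v - x v)"
  unfolding optimal_def
proof (intro conjI ballI)
  show "(\<lambda>v. edge_deg E v - x v) \<in> degree_seqs E"
    using complement_degree_seqs optimalD(1)[OF assms] .
  fix y assume "y \<in> degree_seqs E"
  then have "deviation V h x \<le> deviation V h (\<lambda>v. edge_deg E v - y v)"
    using optimalD(2)[OF assms] complement_degree_seqs by blast
  also have "\<dots> = deviation V (\<lambda>v. edge_deg E v - h v) y"
    unfolding deviation_def by (rule sum.cong) auto
  finally show "deviation V (\<lambda>v. edge_deg E v - h v) (\<lambda>v. edge_deg E v - x v)
      \<le> deviation V (\<lambda>v. edge_deg E v - h v) y"
    by (simp add: complement_deviation)
qed

lemma edge_deg_eq_card: "edge_deg E v = int (card {w \<in> V. {v, w} \<in> E})"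
proof -
  have "{e \<in> E. v \<in> e} = (\<lambda>w. {v, w}) ` {w \<in> V. {v, w} \<in> E}"
  proof (intro equalityI subsetI)
    fix e assume e: "e \<in> {e \<in> E. v \<in> e}"
    then obtain w where "w \<in> V" "e = {v, w}" using other_endE[of e v] by blast
    with e show "e \<in> (\<lambda>w. {v, w}) ` {w \<in> V. {v, w} \<in> E}" by simp
  qed auto
  moreover have "inj_on (\<lambda>w. {v, w}) {w \<in> V. {v, w} \<in> E}"
    by (auto simp: inj_on_def doubleton_eq_iff)
  ultimately show ?thesis by (simp add: edge_deg_def card_image)
qed

lemma set_graph_delete_vertex: "set_graph (V - {v}) {e \<in> E. v \<notin> e}"
  using finite_V edgeE by unfold_locales (auto, blast)

lemma edge_deg_delete_vertex:
  assumes "w \<noteq> v"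
  shows "edge_deg {e \<in> E. v \<notin> e} w = edge_deg E w - (if {v, w} \<in> E then 1 else 0)"
proof -
  interpret D: set_graph "V - {v}" "{e \<in> E. v \<notin> e}" by (rule set_graph_delete_vertex)
  have "{u \<in> V - {v}. {w, u} \<in> {e \<in> E. v \<notin> e}} =
      {u \<in> V. {w, u} \<in> E} - (if {v, w} \<in> E then {v} else {})"
    using assms by (auto simp: insert_commute)
  then have eq: "edge_deg {e \<in> E. v \<notin> e} w =
      int (card ({u \<in> V. {w, u} \<in> E} - (if {v, w} \<in> E then {v} else {})))"
    by (simp only: D.edge_deg_eq_card)
  show ?thesis
  proof (cases "{v, w} \<in> E")
    case True
    then have "v \<in> {u \<in> V. {w, u} \<in> E}" using edgeD[OF True] by (simp add: insert_commute)
    then have "card {u \<in> V. {w, u} \<in> E} = Suc (card ({u \<in> V. {w, u} \<in> E} - {v}))"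
      using finite_V by (intro card.remove) auto
    with True show ?thesis unfolding eq edge_deg_eq_card[of w] by simp
  next
    case False
    then show ?thesis unfolding eq edge_deg_eq_card[of w] by simp
  qed
qed

text \<open>This is \<open>delete_vertex_above\<close> in the complement. Subgraphs without edges at
  \<open>v\<close> there correspond to subgraphs with all edges at \<open>v\<close> here, so each
  neighbour of \<open>v\<close> needs one edge less.\<close>

lemma delete_vertex_below:
  assumes y: "optimal h y" "y v < h v"
    and never: "\<And>x. optimal h x \<Longrightarrow> x v \<le> h v"
    and v: "v \<in> V" and F: "F \<subseteq> {e \<in> E. v \<notin> e}"
  shows "deviation V h y + (edge_deg E v - h v)
    \<le> deviation (V - {v}) (\<lambda>w. h w - (if {v, w} \<in> E then 1 else 0)) (edge_deg F)"
proof -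
  let ?E = "{e \<in> E. v \<notin> e}"
  have "deviation V h y + (edge_deg E v - h v)
      \<le> deviation (V - {v}) (\<lambda>w. edge_deg E w - h w) (edge_deg (?E - F))"
  proof (subst complement_deviation[symmetric], rule delete_vertex_above[OF complement_optimal[OF y(1)]])
    fix x assume "optimal (\<lambda>w. edge_deg E w - h w) x"
    from never[of "\<lambda>w. edge_deg E w - x w"] complement_optimal[OF this]
    show "edge_deg E v - h v \<le> x v" by simp
  qed (use y v in auto)
  also have "\<dots> = deviation (V - {v}) (\<lambda>w. h w - (if {v, w} \<in> E then 1 else 0)) (edge_deg F)"
    unfolding deviation_def
  proof (rule sum.cong[OF refl])
    fix w assume "w \<in> V - {v}"
    moreover have "edge_deg (?E - F) w = edge_deg ?E w - edge_deg F w"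
      using F finite_E by (intro edge_deg_Diff) auto
    ultimately show "\<bar>edge_deg (?E - F) w - (edge_deg E w - h w)\<bar> =
        \<bar>edge_deg F w - (h w - (if {v, w} \<in> E then 1 else 0))\<bar>"
      by (simp add: edge_deg_delete_vertex)
  qed
  finally show ?thesis .
qed

end

text \<open>Tutte's \<open>f\<close>-factor theorem, in deficiency form and without the parity condition on \<open>K\<close>.\<close>

theorem ex_barrier:
  assumes "set_graph V E" "\<And>F. F \<subseteq> E \<Longrightarrow> m \<le> deviation V h (edge_deg F)"
  shows "\<exists>S T K. S \<subseteq> V \<and> T \<subseteq> V \<and> S \<inter> T = {} \<and> separated E (V - S - T) K \<and>
    barrier_value V E h S T K \<le> - m"
  using assms
proof (induction "card V" arbitrary: V E h m rule: less_induct)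
  case less
  interpret set_graph V E by fact
  obtain y where y: "optimal h y" using ex_optimal by blast
  have m: "m \<le> deviation V h x" if "optimal h x" for x
    using optimalD(1)[OF that] less.prems(2) by (auto simp: degree_seqs_def)
  consider
      (above) v x where "v \<in> V" "optimal h x" "h v < x v" "\<And>x. optimal h x \<Longrightarrow> h v \<le> x v"
    | (below) v x where "v \<in> V" "optimal h x" "x v < h v" "\<And>x. optimal h x \<Longrightarrow> x v \<le> h v"
    | (bal) "\<And>v. v \<in> V \<Longrightarrow> (\<exists>x. optimal h x \<and> x v < h v) \<longleftrightarrow> (\<exists>x. optimal h x \<and> h v < x v)"
    by (meson not_le)
  then show ?case
  proof cases
    case above
    let ?V = "V - {v}" and ?E = "{e \<in> E. v \<notin> e}"
    have "\<exists>S T K. S \<subseteq> ?V \<and> T \<subseteq> ?V \<and> S \<inter> T = {} \<and> separated ?E (?V - S - T) K \<and>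
        barrier_value ?V ?E h S T K \<le> - (m + h v)"
    proof (rule less.hyps[OF _ set_graph_delete_vertex])
      show "card ?V < card V" using finite_V above(1) by (rule card_Diff1_less)
      fix F assume "F \<subseteq> ?E"
      then show "m + h v \<le> deviation ?V h (edge_deg F)"
        using delete_vertex_above[of h x v F] above m[OF above(2)] by force
    qed
    then obtain S T K where STK: "S \<subseteq> ?V" "T \<subseteq> ?V" "S \<inter> T = {}" "separated ?E (?V - S - T) K"
      "barrier_value ?V ?E h S T K \<le> - (m + h v)" by blast
    have eq: "?V - S - T = V - insert v S - T" "?V - S = V - insert v S" by auto
    have fin: "finite S" using STK(1) finite_V by (meson finite_Diff finite_subset)
    have "separated E (V - insert v S - T) K"
      using STK(4) unfolding eq separated_def by fastforce
    moreover have "barrier_value V E h (insert v S) T K = barrier_value ?V ?E h S T K + h v"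
    proof -
      have "{w \<in> ?V - S. {u, w} \<in> ?E} = {w \<in> V - insert v S. {u, w} \<in> E}" if "u \<in> T" for u
        using that STK(2) by auto
      moreover have "v \<notin> S" using STK(1) by auto
      ultimately show ?thesis using fin by (simp add: barrier_value_def)
    qed
    ultimately show ?thesis
      using STK above(1) by (intro exI[of _ "insert v S"] exI[of _ T] exI[of _ K]) auto
  next
    case below
    let ?V = "V - {v}" and ?E = "{e \<in> E. v \<notin> e}"
    let ?c = "\<lambda>w. if {v, w} \<in> E then 1 else 0 :: int"
    let ?h = "\<lambda>w. h w - ?c w"
    let ?m = "m + (edge_deg E v - h v)"
    have "\<exists>S T K. S \<subseteq> ?V \<and> T \<subseteq> ?V \<and> S \<inter> T = {} \<and> separated ?E (?V - S - T) K \<and>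
        barrier_value ?V ?E ?h S T K \<le> - ?m"
    proof (rule less.hyps[OF _ set_graph_delete_vertex])
      show "card ?V < card V" using finite_V below(1) by (rule card_Diff1_less)
      fix F assume "F \<subseteq> ?E"
      then show "?m \<le> deviation ?V ?h (edge_deg F)"
        using delete_vertex_below[of h x v F] below m[OF below(2)] by force
    qed
    then obtain S T K where STK: "S \<subseteq> ?V" "T \<subseteq> ?V" "S \<inter> T = {}" "separated ?E (?V - S - T) K"
      "barrier_value ?V ?E ?h S T K \<le> - ?m" by blast
    have eq: "?V - S - T = V - S - insert v T" by auto
    have fin: "finite S" "finite T" using STK(1,2) finite_V by (meson finite_Diff finite_subset)+
    have v: "v \<notin> S" "v \<notin> T" using STK(1,2) by auto
    have sep: "separated E (V - S - insert v T) K"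
      using STK(4) unfolding eq separated_def by fastforce
    \<comment> \<open>Lowering \<open>h\<close> on \<open>T\<close> accounts for the edges between
      \<open>T\<close> and \<open>v\<close>, which count again once \<open>v\<close> is back;
      lowering it on \<open>S\<close> accounts for the edges from \<open>v\<close> to
      \<open>S\<close>, absent from the degree of \<open>v\<close> in \<open>G - S\<close>.\<close>
    have T_sum: "(\<Sum>u\<in>T. int (card {w \<in> V - S. {u, w} \<in> E})) =
        (\<Sum>u\<in>T. int (card {w \<in> ?V - S. {u, w} \<in> ?E})) + sum ?c T"
      unfolding sum.distrib[symmetric]
    proof (rule sum.cong[OF refl])
      fix u assume u: "u \<in> T"
      have "{w \<in> V - S. {u, w} \<in> E} = {w \<in> ?V - S. {u, w} \<in> ?E} \<union> (if {v, u} \<in> E then {v} else {})"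
        using u v below(1) by (auto simp: insert_commute)
      also have "card \<dots> = card {w \<in> ?V - S. {u, w} \<in> ?E} + card (if {v, u} \<in> E then {v} else {})"
        by (rule card_Un_disjoint) (use finite_V in auto)
      finally show "int (card {w \<in> V - S. {u, w} \<in> E}) = int (card {w \<in> ?V - S. {u, w} \<in> ?E}) + ?c u"
        by simp
    qed
    have v_deg: "edge_deg E v = int (card {w \<in> V - S. {v, w} \<in> E}) + sum ?c S"
    proof -
      have "{w \<in> V. {v, w} \<in> E} = {w \<in> V - S. {v, w} \<in> E} \<union> {w \<in> S. {v, w} \<in> E}"
        using STK(1) by auto
      then have "card {w \<in> V. {v, w} \<in> E} = card {w \<in> V - S. {v, w} \<in> E} + card {w \<in> S. {v, w} \<in> E}"
        using finite_V fin by (simp add: card_Un_disjoint disjoint_iff)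
      then show ?thesis using fin by (simp add: edge_deg_eq_card sum.If_cases Int_def)
    qed
    have "barrier_value V E h S (insert v T) K = barrier_value ?V ?E ?h S T K + edge_deg E v - h v"
      unfolding barrier_value_def using fin v T_sum v_deg by (simp add: sum_subtractf)
    then show ?thesis
      using STK below(1) sep v
      by (intro exI[of _ S] exI[of _ "insert v T"] exI[of _ K]) auto
  next
    case bal
    interpret balanced_graph V E h by unfold_locales (rule bal)
    obtain K where "separated E V K" "deviation V h y \<le> int (card K)"
      using deviation_le_separated[OF y] by blast
    then show ?thesis using m[OF y]
      by (intro exI[of _ "{}"] exI[of _ K]) (auto simp: barrier_value_def)
  qed
qed

section \<open>Counting\<close>

text \<open>
  Here \<open>p = n / (a + b)\<close>, \<open>s = \<bar>S\<bar>\<close>, \<open>q = \<bar>K\<bar>\<close>, the numbers of vertices of \<open>T\<close> of degree at least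
  \<open>b p\<close> and less than \<open>b p\<close> are \<open>t\<^sub>H\<close> and \<open>t\<^sub>L\<close>, and \<open>d\<^sub>H\<close> and \<open>d\<^sub>L\<close> are the sums of their degrees in
  \<open>G - S\<close>.
\<close>

lemma counting_bounds:
  fixes a b p s t\<^sub>H t\<^sub>L q d\<^sub>H d\<^sub>L :: real
  assumes ab: "1 \<le> a" "a + 2 \<le> b" and p: "3 * (b + 1) \<le> p"
    and nonneg: "0 \<le> s" "0 \<le> t\<^sub>H" "0 \<le> t\<^sub>L" "0 \<le> q" "0 \<le> d\<^sub>H" "0 \<le> d\<^sub>L"
    and total: "s + t\<^sub>H + t\<^sub>L + q \<le> (a + b) * p"
    and barrier: "a * s - b * (t\<^sub>H + t\<^sub>L) + d\<^sub>H + d\<^sub>L + 2 \<le> q"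
    and d\<^sub>H: "t\<^sub>H * (b * p - s) \<le> d\<^sub>H"
    and d\<^sub>L: "t\<^sub>L * (t\<^sub>L - 1) \<le> d\<^sub>L"
    and t\<^sub>H: "a + b \<le> t\<^sub>H \<or> t\<^sub>H \<le> a + b - 1"
    and comps: "1 \<le> q \<Longrightarrow>
      (q - 1) * (b * p + 1 - (s + t\<^sub>H + t\<^sub>L)) + 1 + (s + t\<^sub>H + t\<^sub>L) \<le> (a + b) * p"
  shows "q < 3" "s \<le> b * p - (a + b)"
proof -
  have b3: "3 \<le> b" using ab by linarith
  define k where "k = b * p - s"
  have b_total: "b * (t\<^sub>H + t\<^sub>L) \<le> b * ((a + b) * p - s - q)"
    by (rule mult_left_mono) (use total b3 in linarith)+
  have q_b: "0 \<le> (b - 1) * q" using b3 nonneg by simp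
  have "k * t\<^sub>H \<le> d\<^sub>H" using d\<^sub>H by (simp add: k_def mult.commute)
  \<comment> \<open>Replacing \<open>t\<^sub>H + t\<^sub>L\<close> by its bound from
    \<open>total\<close> brings the barrier into product form; once \<open>k > 0\<close> is known,
    it excludes \<open>t\<^sub>H \<ge> a + b\<close>.\<close>
  then have kt: "(t\<^sub>H - (a + b)) * k \<le> - 2"
    using b_total q_b barrier nonneg(6) unfolding k_def by (simp add: algebra_simps)
  have k0: "0 < k"
  proof (rule ccontr)
    assume "\<not> 0 < k"
    then have "(a + b) * k \<le> 0" using ab by (simp add: mult_nonneg_nonpos)
    then show False
      using b_total q_b barrier nonneg(5,6) unfolding k_def by (simp add: algebra_simps)
  qed
  have "\<not> a + b \<le> t\<^sub>H"
  proof
    assume "a + b \<le> t\<^sub>H"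
    then have "0 \<le> (t\<^sub>H - (a + b)) * k" using k0 by simp
    with kt show False by linarith
  qed
  then have t\<^sub>H_le: "t\<^sub>H \<le> a + b - 1" using t\<^sub>H by blast
  \<comment> \<open>The coefficient \<open>a * (b - 1)\<close> equals
    \<open>(a + 1) * b - (a + b)\<close>: it is what remains of \<open>(a + 1) * s\<close> near
    \<open>s = b * p\<close> after subtracting the total \<open>(a + b) * p\<close>.\<close>
  have p_a: "3 * (a * (b\<^sup>2 - 1)) \<le> a * (b - 1) * p"
  proof -
    have "(a * (b - 1)) * (3 * (b + 1)) \<le> (a * (b - 1)) * p"
      by (rule mult_left_mono[OF p]) (use ab b3 in simp)
    then show ?thesis by (simp add: algebra_simps power2_eq_square)
  qed
  have aa: "a * a \<le> a * (b - 2)" by (rule mult_left_mono) (use ab in linarith)+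
  have bb: "3 * b \<le> b * b" by (rule mult_right_mono) (use b3 in linarith)+
  show k_ge: "s \<le> b * p - (a + b)"
  proof (rule ccontr)
    assume "\<not> ?thesis"
    then have k: "k < a + b" by (simp add: k_def)
    have "0 \<le> k * t\<^sub>H" using k0 nonneg by simp
    then have "a * s - b * (t\<^sub>H + t\<^sub>L) + t\<^sub>L * (t\<^sub>L - 1) + 2 \<le> (a + b) * p - s - t\<^sub>H - t\<^sub>L"
      using barrier total d\<^sub>L \<open>k * t\<^sub>H \<le> d\<^sub>H\<close> by linarith
    moreover have "(b - 1) * t\<^sub>H \<le> (b - 1) * (a + b - 1)"
      by (rule mult_left_mono[OF t\<^sub>H_le]) (use b3 in simp)
    moreover have "(a + 1) * k \<le> (a + 1) * (a + b)"
      by (rule mult_left_mono) (use k ab in simp_all)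
    \<comment> \<open>Completes the square in the collected terms
      \<open>t\<^sub>L * t\<^sub>L - b * t\<^sub>L\<close>.\<close>
    moreover have "0 \<le> (t\<^sub>L - b / 2)\<^sup>2" by simp
    moreover have "1 * (3 * (b * b) - 3 * b - 1) \<le> a * (3 * (b * b) - 3 * b - 1)"
      by (rule mult_right_mono) (use ab bb b3 in linarith)+
    ultimately show False
      using p_a aa bb b3 unfolding k_def by (simp add: algebra_simps power2_eq_square)
  qed
  show "q < 3"
  proof (rule ccontr)
    assume "\<not> q < 3"
    then have q3: "3 \<le> q" by simp
    \<comment> \<open>\<open>M\<close> is the maximum of \<open>(a + b + 1) * t - t * t\<close>: the
      price for replacing the quadratic bound on \<open>d\<^sub>L\<close> by one that is linear in
      \<open>u\<close>.\<close>
    define M u where "M = (a + b + 1)\<^sup>2 / 4" and "u = s + t\<^sub>H + t\<^sub>L"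
    have M: "M \<le> b\<^sup>2"
    proof -
      have "(a + b + 1)\<^sup>2 \<le> (2 * b)\<^sup>2" by (rule power_mono) (use ab in linarith)+
      then show ?thesis by (simp add: M_def power_mult_distrib)
    qed
    have "t\<^sub>H * (a + b) \<le> t\<^sub>H * k"
      by (rule mult_left_mono) (use k_ge nonneg in \<open>simp_all add: k_def\<close>)
    moreover have "0 \<le> (t\<^sub>L - (a + b + 1) / 2)\<^sup>2" by simp
    ultimately have q_ge: "a * u - M + 2 \<le> q"
      using barrier d\<^sub>L \<open>k * t\<^sub>H \<le> d\<^sub>H\<close> unfolding u_def M_def
      by (simp add: algebra_simps power2_eq_square add_divide_distrib)
    have pb: "3 * (b\<^sup>2 - 1) \<le> a * (b - 1) * p"
    proof -
      have "0 \<le> b\<^sup>2 - 1" using bb b3 unfolding power2_eq_square by linarith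
      with ab(1) have "1 * (b\<^sup>2 - 1) \<le> a * (b\<^sup>2 - 1)" by (rule mult_right_mono)
      with p_a show ?thesis by linarith
    qed
    have M_less: "M < 3 * (b\<^sup>2 - 1)" using M bb b3 unfolding power2_eq_square right_diff_distrib by linarith
    show False
    proof (cases "b * p \<le> u")
      case True
      then have "a * (b * p) \<le> a * u" using ab by simp
      then show False
        using q_ge total True pb M_less unfolding u_def by (simp add: algebra_simps)
    next
      case False
      define w where "w = b * p - u"
      have w0: "0 < w" using False by (simp add: w_def)
      have comps': "(q - 1) * (w + 1) + 1 - w \<le> a * p"
        using comps q3 unfolding w_def u_def by (simp add: algebra_simps)
      have "2 * (w + 1) \<le> (q - 1) * (w + 1)" by (rule mult_right_mono) (use q3 w0 in simp_all)
      then have w_le: "w \<le> a * p - 3" using comps' by (simp add: algebra_simps)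
      have X: "(a * (b * p - w) - M + 1) * (w + 1) \<le> (q - 1) * (w + 1)"
        by (rule mult_right_mono) (use q_ge w0 in \<open>simp_all add: w_def\<close>)
      have "0 \<le> (a - 1) * (b - 1 - a)" using ab by simp
      then have "b - 1 \<le> a * (b - a)" by (simp add: algebra_simps)
      moreover have "0 \<le> p" using p b3 by simp
      ultimately have "(b - 1) * p \<le> a * (b - a) * p" by (rule mult_right_mono)
      moreover have "(b - 1) * (3 * (b + 1)) \<le> (b - 1) * p"
        by (rule mult_left_mono[OF p]) (use b3 in simp)
      moreover have "a * w \<le> a * (a * p - 3)" using w_le ab by simp
      ultimately have "0 \<le> a * (b * p) - M - a - a * w"
        using M_less ab by (simp add: algebra_simps power2_eq_square)
      \<comment> \<open>Expanding \<open>X\<close> against \<open>comps'\<close> leaves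
        \<open>a * (b - 1) * p - M + 2\<close> plus this product, at most 0. The bound
        \<open>w \<le> a * p - 3\<close>, from \<open>q \<ge> 3\<close>, makes the bracket
        nonnegative.\<close>
      then have "0 \<le> w * (a * (b * p) - M - a - a * w)" using w0 by simp
      then show False
        using X comps' pb M_less by (simp add: algebra_simps)
    qed
  qed
qed

text \<open>
  Here \<open>t\<close> is the number of vertices of small degree in \<open>T\<close>, \<open>d\<close> their minimum degree in \<open>G - S\<close>, and
  \<open>\<delta>\<close> the minimum degree of \<open>G\<close>.
\<close>

lemma clique_bound:
  fixes a b s t d \<delta> :: real
  assumes ab: "1 \<le> a" "a + 2 \<le> b" and \<delta>: "b\<^sup>2 - b \<le> a * \<delta>" "\<delta> - s \<le> d"
    and t: "1 \<le> t" "t \<le> d + 1" and s: "s = 0 \<or> 1 \<le> s" and d: "b \<le> d \<or> d \<le> b - 1"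
  shows "0 < a * s + t * (d - b)"
proof (cases "b \<le> d")
  case True
  then have td: "0 \<le> t * (d - b)" using t by simp
  show ?thesis
  proof (cases "s = 0")
    case True
    \<comment> \<open>If \<open>\<delta> \<le> b\<close>, then
      \<open>a * \<delta> \<le> (b - 2) * b\<close>, which is less than
      \<open>b\<^sup>2 - b\<close>.\<close>
    have "b < \<delta>"
    proof (rule ccontr)
      assume "\<not> b < \<delta>"
      then have "a * \<delta> \<le> a * b" using ab by simp
      also have "\<dots> \<le> (b - 2) * b" using ab by (intro mult_right_mono) auto
      finally show False using \<delta>(1) ab by (simp add: algebra_simps power2_eq_square)
    qed
    then show ?thesis using True \<delta>(2) t by simp
  next
    case False
    then have "1 \<le> s" using s by simp
    then have "0 < a * s" using ab by simp
    with td show ?thesis by linarith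
  qed
next
  case False
  then have db: "d \<le> b - 1" using d by blast
  have "a * (\<delta> - d) \<le> a * s" using \<delta>(2) ab by simp
  moreover have "t * (b - d) \<le> (d + 1) * (b - d)" by (rule mult_right_mono) (use t db in auto)
  moreover have "a * d \<le> (b - 2) * d" by (rule mult_right_mono) (use ab t in auto)
  \<comment> \<open>With \<open>e = b - d\<close> the lower bound becomes
    \<open>e\<^sup>2 - 3 * e + b\<close>, that is \<open>(e - 3 / 2)\<^sup>2 + b - 9 / 4\<close>,
    positive as \<open>b \<ge> 3\<close>.\<close>
  moreover have "0 \<le> (b - d - 3 / 2)\<^sup>2" by simp
  ultimately show ?thesis
    using \<delta>(1) ab by (simp add: algebra_simps power2_eq_square)
qed

section \<open>Excluding barriers under the degree condition\<close>

context set_graph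
begin

lemma handshake: "F \<subseteq> E \<Longrightarrow> even (\<Sum>v\<in>V. edge_deg F v)"
proof -
  assume F: "F \<subseteq> E"
  have "finite F" using finite_sub[OF F] .
  then show ?thesis using F
  proof (induction F)
    case empty
    then show ?case by (simp add: edge_deg_def)
  next
    case (insert e F)
    obtain u v where e: "u \<in> V" "v \<in> V" "u \<noteq> v" "e = {u, v}" using edgeE[of e] insert.prems by blast
    have "(\<Sum>w\<in>V. edge_deg (insert e F) w) =
        (\<Sum>w\<in>V. edge_deg F w + (if w = u then 1 else 0) + (if w = v then 1 else 0))"
      by (rule sum.cong[OF refl]) (use insert.hyps e in \<open>simp add: edge_deg_insert\<close>)
    also have "\<dots> = (\<Sum>w\<in>V. edge_deg F w) + 2"
      using e finite_V by (simp add: sum.distrib)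
    finally show ?case using insert by simp
  qed
qed

lemma even_deviation:
  assumes "F \<subseteq> E" "even (\<Sum>v\<in>V. h v)"
  shows "even (deviation V h (edge_deg F))"
proof -
  have "even (\<Sum>v\<in>V. \<bar>edge_deg F v - h v\<bar>) \<longleftrightarrow> even (\<Sum>v\<in>V. edge_deg F v - h v)"
    using finite_V by (simp add: even_sum_iff)
  then show ?thesis
    using handshake[OF assms(1)] assms(2) by (simp add: deviation_def sum_subtractf)
qed

text \<open>All but at most one member of \<open>K\<close> contain a vertex of large degree, since the vertices of
  small degree form a clique.\<close>

lemma separated_card_bound:
  fixes r :: real
  assumes ST: "S \<subseteq> V" "T \<subseteq> V" "S \<inter> T = {}" and K: "separated E (V - S - T) K"
    and clique: "\<And>u v. u \<in> V \<Longrightarrow> v \<in> V \<Longrightarrow> u \<noteq> v \<Longrightarrow> edge_deg E u < r \<Longrightarrow> edge_deg E v < r \<Longrightarrow>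
      {u, v} \<in> E"
  shows "card S + card T + card K \<le> card V"
    and "K \<noteq> {} \<Longrightarrow> (real (card K) - 1) * (r + 1 - (real (card S) + real (card T)))
      + 1 + (real (card S) + real (card T)) \<le> real (card V)"
proof -
  let ?W = "V - S - T" and ?c = "r + 1 - (real (card S) + real (card T))"
  have fin: "finite S" "finite T" "finite ?W" using ST finite_V finite_subset by auto
  have mem: "C \<noteq> {}" "C \<subseteq> ?W" "finite C" if "C \<in> K" for C
    using separatedD(1,2)[OF K that] finite_subset[OF _ fin(3)] by simp_all
  have closed: "y \<in> C" if "C \<in> K" "x \<in> C" "y \<in> ?W" "{x, y} \<in> E" for C x y
    using separatedD(3)[OF K that] .
  have finK: "finite K" by (rule finite_subset[of K "Pow ?W"]) (use mem(2) fin(3) in auto)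
  have disj: "C \<inter> D = {}" if "C \<in> K" "D \<in> K" "C \<noteq> D" for C D
    using separatedD(4)[OF K that] .
  have card_ge1: "1 \<le> card C" if "C \<in> K" for C
    using mem[OF that] by (simp add: Suc_le_eq card_gt_0_iff)
  have "card (\<Union>K) = (\<Sum>C\<in>K. card C)"
    by (rule card_Union_disjoint) (use disj mem(3) in \<open>simp_all add: pairwise_def disjnt_def\<close>)
  moreover have "card (\<Union>K) \<le> card ?W" using mem fin by (intro card_mono) auto
  moreover have "card ?W + card S + card T = card V"
  proof -
    have "card V = card (V - S) + card S" using ST fin by (metis card_Diff_subset card_mono finite_V le_add_diff_inverse2)
    moreover have "card (V - S) = card ?W + card T"
      using ST fin by (metis card_Diff_subset card_mono finite_Diff finite_V le_add_diff_inverse2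
          Diff_subset Int_commute Diff_triv Diff_mono order_refl)
    ultimately show ?thesis by simp
  qed
  ultimately have total: "card S + card T + (\<Sum>C\<in>K. card C) \<le> card V" by linarith
  have "card K \<le> (\<Sum>C\<in>K. card C)" using sum_mono[of K "\<lambda>_. 1" card] card_ge1 by simp
  with total show "card S + card T + card K \<le> card V" by linarith
  \<comment> \<open>Since \<open>C\<close> is closed, the neighbours of \<open>y\<close> lie in
    \<open>C - {y}\<close>, \<open>S\<close> or \<open>T\<close>; the omitted \<open>y\<close> gives
    the \<open>+ 1\<close> in \<open>?c\<close>.\<close>
  have big: "?c \<le> card C" if C: "C \<in> K" "y \<in> C" "r \<le> edge_deg E y" for C y
  proof -
    have "{w \<in> V. {y, w} \<in> E} \<subseteq> (C - {y}) \<union> S \<union> T"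
    proof
      fix w assume "w \<in> {w \<in> V. {y, w} \<in> E}"
      then show "w \<in> (C - {y}) \<union> S \<union> T" using closed[OF C(1,2), of w] edgeD[of y w] by auto
    qed
    then have "card {w \<in> V. {y, w} \<in> E} \<le> card ((C - {y}) \<union> S \<union> T)"
      using fin mem(3)[OF C(1)] by (intro card_mono) auto
    also have "\<dots> \<le> card (C - {y}) + card S + card T"
      by (meson add_le_mono1 card_Un_le le_trans)
    also have "card (C - {y}) = card C - 1" using C by simp
    finally show ?thesis
      using C(3) card_ge1[OF C(1)] unfolding edge_deg_eq_card by simp
  qed
  assume K_ne: "K \<noteq> {}"
  \<comment> \<open>\<open>C0\<close> is a member with small degrees only, if there is one: a small
    vertex of another member would be adjacent to it, against closedness. Otherwise any member
    serves.\<close>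
  obtain C0 where C0: "C0 \<in> K" "\<And>C. C \<in> K - {C0} \<Longrightarrow> ?c \<le> card C"
  proof (cases "\<forall>C\<in>K. \<exists>y\<in>C. r \<le> edge_deg E y")
    case True
    then show ?thesis using that K_ne big by (metis DiffD1 ex_in_conv)
  next
    case False
    then obtain C0 where 0: "C0 \<in> K" "\<And>y. y \<in> C0 \<Longrightarrow> edge_deg E y < r" by (meson not_le)
    obtain x where x: "x \<in> C0" using mem(1)[OF 0(1)] by blast
    have "?c \<le> card C" if C: "C \<in> K - {C0}" for C
    proof -
      obtain y where y: "y \<in> C" using mem(1) C by blast
      have "y \<notin> C0" using disj[of C C0] C 0 y by blast
      moreover have "y \<in> ?W" "x \<in> ?W" using mem(2) C 0(1) x y by blast+
      ultimately have "\<not> edge_deg E y < r"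
        using closed[OF 0(1) x, of y] clique[of x y] 0(2)[OF x] x by auto
      then show ?thesis using big[of C y] C y by simp
    qed
    then show ?thesis using that 0(1) by blast
  qed
  have "card K = Suc (card (K - {C0}))" using finK C0(1) by (rule card.remove)
  then have "(real (card K) - 1) * ?c = (\<Sum>C\<in>K - {C0}. ?c)" by simp
  also have "\<dots> \<le> (\<Sum>C\<in>K - {C0}. real (card C))" by (rule sum_mono) (use C0 in auto)
  also have "\<dots> = (\<Sum>C\<in>K. real (card C)) - real (card C0)"
    using C0(1) finK by (simp add: sum_diff1)
  also have "\<dots> \<le> (\<Sum>C\<in>K. real (card C)) - 1" using card_ge1[OF C0(1)] by simp
  finally have "(real (card K) - 1) * ?c \<le> real (\<Sum>C\<in>K. card C) - 1" by simp
  moreover have "real (card S) + real (card T) + real (\<Sum>C\<in>K. card C) \<le> real (card V)"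
    using total by (metis of_nat_add of_nat_le_iff)
  ultimately show "(real (card K) - 1) * ?c + 1 + (real (card S) + real (card T)) \<le> real (card V)"
    by linarith
qed

text \<open>By parity a missing factor forces deviation at least 2, whence a barrier of value at
  most -2. Connectedness is phrased with closed sets so that it applies directly to the members of
  \<open>K\<close>.\<close>

lemma ex_parity_factor:
  fixes a b :: nat and h :: "'a \<Rightarrow> int"
  assumes ab: "1 \<le> a" "a + 2 \<le> b" and n: "3 * (b + 1) * (a + b) \<le> card V"
    and conn: "\<And>C. C \<noteq> {} \<Longrightarrow> C \<subseteq> V \<Longrightarrow> (\<And>x y. x \<in> C \<Longrightarrow> y \<in> V \<Longrightarrow> {x, y} \<in> E \<Longrightarrow> y \<in> C) \<Longrightarrow> C = V"
    and min_deg: "\<And>v. v \<in> V \<Longrightarrow> (real b)\<^sup>2 - real b \<le> real a * edge_deg E v"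
    and clique: "\<And>u v. u \<in> V \<Longrightarrow> v \<in> V \<Longrightarrow> u \<noteq> v \<Longrightarrow>
      edge_deg E u < real b * real (card V) / (real a + real b) \<Longrightarrow>
      edge_deg E v < real b * real (card V) / (real a + real b) \<Longrightarrow> {u, v} \<in> E"
    and h: "\<And>v. v \<in> V \<Longrightarrow> int a \<le> h v \<and> h v \<le> int b" "even (\<Sum>v\<in>V. h v)"
  shows "\<exists>F\<subseteq>E. \<forall>v\<in>V. edge_deg F v = h v"
proof (rule ccontr)
  assume no: "\<not> ?thesis"
  define p where "p = real (card V) / (real a + real b)"
  have ab_pos: "0 < real a + real b" using ab by simp
  have p_n: "(real a + real b) * p = real (card V)" using ab_pos by (simp add: p_def)
  have p_ge: "3 * (real b + 1) \<le> p"
  proof -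
    have "real (3 * (b + 1) * (a + b)) \<le> real (card V)" using n by (simp only: of_nat_le_iff)
    then show ?thesis using ab_pos by (simp add: p_def pos_le_divide_eq algebra_simps)
  qed
  have clique': "{u, v} \<in> E" if "u \<in> V" "v \<in> V" "u \<noteq> v" "edge_deg E u < b * p" "edge_deg E v < b * p" for u v
    using clique[OF that(1-3)] that(4,5) by (simp add: p_def)
  have "2 \<le> deviation V h (edge_deg F)" if F: "F \<subseteq> E" for F
  proof -
    have "deviation V h (edge_deg F) \<noteq> 0"
      using no F finite_V by (auto simp: deviation_def sum_nonneg_eq_0_iff)
    then show ?thesis
      using even_deviation[OF F h(2)] deviation_nonneg[of V h "edge_deg F"] by presburger
  qed
  from ex_barrier[OF set_graph_axioms this]
  obtain S T K where ST: "S \<subseteq> V" "T \<subseteq> V" "S \<inter> T = {}" and K: "separated E (V - S - T) K"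
    and barrier: "barrier_value V E h S T K \<le> - 2" by blast
  have fin: "finite S" "finite T" using ST finite_V finite_subset by blast+
  define dS where "dS v = card {w \<in> V - S. {v, w} \<in> E}" for v
  define L where "L = {v \<in> T. edge_deg E v < b * p}"
  define d\<^sub>H d\<^sub>L where "d\<^sub>H = (\<Sum>v\<in>T - L. real (dS v))" and "d\<^sub>L = (\<Sum>v\<in>L. real (dS v))"
  let ?s = "real (card S)" and ?tH = "real (card (T - L))" and ?tL = "real (card L)"
    and ?q = "real (card K)"
  have L: "L \<subseteq> T" "finite L" using fin by (auto simp: L_def)
  have card_T: "card T = card (T - L) + card L"
    using L fin by (metis card_Diff_subset card_mono le_add_diff_inverse2)
  have deg_le: "edge_deg E v \<le> real (dS v) + ?s" for v
  proof -
    have "card {w \<in> V. {v, w} \<in> E} \<le> card ({w \<in> V - S. {v, w} \<in> E} \<union> S)"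
      using fin finite_V by (intro card_mono) auto
    also have "\<dots> \<le> dS v + card S" unfolding dS_def by (rule card_Un_le)
    finally show ?thesis by (simp add: edge_deg_eq_card)
  qed
  \<comment> \<open>The vertices of \<open>L\<close> are pairwise adjacent and lie outside
    \<open>S\<close>.\<close>
  have L_deg: "?tL - 1 \<le> real (dS v)" if v: "v \<in> L" for v
  proof -
    have "L - {v} \<subseteq> {w \<in> V - S. {v, w} \<in> E}"
    proof
      fix w assume w: "w \<in> L - {v}"
      then show "w \<in> {w \<in> V - S. {v, w} \<in> E}"
        using clique'[of v w] v ST by (auto simp: L_def)
    qed
    then have "card (L - {v}) \<le> dS v"
      unfolding dS_def using finite_V by (intro card_mono) auto
    moreover have "card (L - {v}) = card L - 1" using v by simp
    ultimately show ?thesis by linarith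
  qed
  have main: "real a * ?s - real b * (?tH + ?tL) + d\<^sub>H + d\<^sub>L + 2 \<le> ?q"
  proof -
    have "int a * int (card S) \<le> sum h S"
      using sum_mono[of S "\<lambda>_. int a" h] h(1) ST by (auto simp: mult.commute)
    moreover have "sum h T \<le> int b * int (card T)"
      using sum_mono[of T h "\<lambda>_. int b"] h(1) ST by (auto simp: mult.commute)
    ultimately have "int a * int (card S) - int b * int (card T) + (\<Sum>v\<in>T. int (dS v)) + 2
        \<le> int (card K)"
      using barrier unfolding barrier_value_def dS_def by linarith
    then have "real_of_int (int a * int (card S) - int b * int (card T) + (\<Sum>v\<in>T. int (dS v)) + 2)
        \<le> real_of_int (int (card K))" by (simp only: of_int_le_iff)
    moreover have "(\<Sum>v\<in>T. real (dS v)) = d\<^sub>H + d\<^sub>L"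
      unfolding d\<^sub>H_def d\<^sub>L_def using sum.subset_diff[OF L(1) fin(2)] by blast
    ultimately show ?thesis using card_T by simp
  qed
  have d\<^sub>H_ge: "?tH * (b * p - ?s) \<le> d\<^sub>H"
  proof -
    have "(\<Sum>v\<in>T - L. b * p - ?s) \<le> d\<^sub>H"
      unfolding d\<^sub>H_def
    proof (rule sum_mono)
      fix v assume "v \<in> T - L"
      then have "b * p \<le> edge_deg E v" by (auto simp: L_def)
      then show "b * p - ?s \<le> real (dS v)" using deg_le[of v] by linarith
    qed
    then show ?thesis by simp
  qed
  have d\<^sub>L_ge: "?tL * c \<le> d\<^sub>L" if "\<And>v. v \<in> L \<Longrightarrow> c \<le> real (dS v)" for c
    using sum_mono[of L "\<lambda>_. c" "\<lambda>v. real (dS v)"] that by (simp add: d\<^sub>L_def)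
  have nonneg: "0 \<le> d\<^sub>H" "0 \<le> d\<^sub>L" by (simp_all add: d\<^sub>H_def d\<^sub>L_def sum_nonneg)
  have total: "?s + ?tH + ?tL + ?q \<le> (real a + real b) * p"
  proof -
    have "card S + card T + card K \<le> card V"
      using separated_card_bound(1)[OF ST K clique'] .
    then have "real (card S + card T + card K) \<le> real (card V)" by (simp only: of_nat_le_iff)
    then show ?thesis using p_n card_T by simp
  qed
  have comps: "(?q - 1) * (b * p + 1 - (?s + ?tH + ?tL)) + 1 + (?s + ?tH + ?tL) \<le> (real a + real b) * p"
    if "1 \<le> ?q"
  proof -
    have "K \<noteq> {}" using that by auto
    from separated_card_bound(2)[OF ST K clique' this] show ?thesis
      using p_n card_T by (simp add: add.assoc)
  qed
  \<comment> \<open>Integrality enters the real estimates as a gap of one.\<close>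
  have "a + b \<le> card (T - L) \<or> card (T - L) + 1 \<le> a + b" by linarith
  then have "real (a + b) \<le> ?tH \<or> real (card (T - L) + 1) \<le> real (a + b)"
    by (simp only: of_nat_le_iff)
  then have "real a + real b \<le> ?tH \<or> ?tH \<le> real a + real b - 1" by auto
  note bounds = counting_bounds[OF _ _ p_ge _ _ _ _ nonneg total main d\<^sub>H_ge d\<^sub>L_ge[OF L_deg] this comps]
  have q: "card K \<le> 2" and s: "?s \<le> b * p - (real a + real b)"
    using bounds ab by auto
  \<comment> \<open>Each vertex of \<open>T - L\<close> keeps degree at least \<open>a + b\<close>
    in \<open>G - S\<close>, a surplus of \<open>a\<close> over \<open>b\<close>.\<close>
  have "real a * ?tH \<le> d\<^sub>H - b * ?tH"
  proof -
    have "?tH * (real a + real b) \<le> ?tH * (b * p - ?s)"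
      by (rule mult_left_mono) (use s in auto)
    then show ?thesis using d\<^sub>H_ge by (simp add: algebra_simps)
  qed
  moreover have "0 \<le> real a * ?tH" by simp
  ultimately have small: "real a * ?s + real a * ?tH + (d\<^sub>L - b * ?tL) + 2 \<le> ?q"
    using main by (simp add: algebra_simps)
  show False
  proof (cases "L = {}")
    case True
    \<comment> \<open>With \<open>card K \<le> 2\<close> nothing is left for \<open>S\<close> and
      \<open>T\<close>. Members of \<open>K\<close> are then closed in the whole graph, so
      connectedness allows just one, yet the barrier needs two.\<close>
    then have "real a * (?s + ?tH) \<le> 0"
      using small q nonneg(2) by (simp add: algebra_simps)
    then have "?s + ?tH \<le> 0" using ab by (simp add: mult_le_0_iff)
    then have "?s = 0" "?tH = 0" by linarith+
    then have "S = {}" "T = {}" using fin True by auto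
    then have "C = V" if "C \<in> K" for C
      using separatedD[OF K that] conn[of C] by simp
    then have "K \<subseteq> {V}" by blast
    then have "card K \<le> card {V}" by (intro card_mono) auto
    then show False using small nonneg(2) True \<open>S = {}\<close> \<open>T = {}\<close> by simp
  next
    case False
    define d where "d = Min (dS ` L)"
    have d_le: "d \<le> dS v" if "v \<in> L" for v using that L by (simp add: d_def)
    have "d \<in> dS ` L" unfolding d_def using L False by (intro Min_in) auto
    then obtain v where v: "v \<in> L" "d = dS v" by blast
    have "real a * ?s + ?tL * (real d - real b) \<le> 0"
    proof -
      have "?tL * real d \<le> d\<^sub>L" by (rule d\<^sub>L_ge) (use d_le in simp)
      moreover have "0 \<le> real a * ?tH" by simp
      moreover have "?q \<le> 2" using q by simp
      moreover have "?tL * (real d - real b) = ?tL * real d - real b * ?tL"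
        by (simp add: algebra_simps)
      ultimately show ?thesis using small by linarith
    qed
    moreover have "0 < real a * ?s + ?tL * (real d - real b)"
    \<comment> \<open>The degree of the minimiser \<open>v\<close> takes the role of
      \<open>\<delta>\<close>, which links it to \<open>d\<close> through
      \<open>deg_le\<close>.\<close>
    proof (rule clique_bound)
      show "(real b)\<^sup>2 - real b \<le> real a * real_of_int (edge_deg E v)"
        using min_deg v L ST by blast
      show "real_of_int (edge_deg E v) - ?s \<le> real d" using deg_le[of v] v by simp
      show "?tL \<le> real d + 1" using L_deg v by fastforce
      show "1 \<le> ?tL" using False L by (simp add: Suc_le_eq card_gt_0_iff)
      have "b \<le> d \<or> d + 1 \<le> b" by linarith
      then have "real b \<le> real d \<or> real (d + 1) \<le> real b" by (simp only: of_nat_le_iff)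
      then show "real b \<le> real d \<or> real d \<le> real b - 1" by auto
      show "?s = 0 \<or> 1 \<le> ?s" by (cases "card S") auto
    qed (use ab in auto)
    ultimately show False by linarith
  qed
qed

end

section \<open>Transfer to digraphs\<close>

definition edge_set :: "('a, 'b) pre_digraph \<Rightarrow> 'a set set" where
  "edge_set G = (\<lambda>e. {tail G e, head G e}) ` arcs G"

text \<open>Selecting arcs by their sets of ends keeps opposite arcs together, so symmetry is
  inherited.\<close>

definition edge_subgraph :: "('a, 'b) pre_digraph \<Rightarrow> 'a set set \<Rightarrow> ('a, 'b) pre_digraph" where
  "edge_subgraph G F = G\<lparr>arcs := {e \<in> arcs G. {tail G e, head G e} \<in> F}\<rparr>"

context graph
begin

lemma reverse_arc:
  assumes "e \<in> arcs G"
  obtains e' where "e' \<in> arcs G" "tail G e' = head G e" "head G e' = tail G e"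
  using sym_arcs assms unfolding symmetric_conv by metis

lemma in_edge_set_iff: "{u, v} \<in> edge_set G \<longleftrightarrow> u \<rightarrow> v"
proof
  assume "{u, v} \<in> edge_set G"
  then obtain e where "e \<in> arcs G" "{u, v} = {tail G e, head G e}" by (auto simp: edge_set_def)
  then have "u \<rightarrow> v \<or> v \<rightarrow> u" by (auto simp: doubleton_eq_iff arcs_ends_conv)
  then show "u \<rightarrow> v" using graph_symmetric by blast
qed (auto simp: edge_set_def arcs_ends_conv)

lemma set_graph_edge_set: "set_graph (verts G) (edge_set G)"
proof
  fix e assume "e \<in> edge_set G"
  then obtain a where "a \<in> arcs G" "e = {tail G a, head G a}" by (auto simp: edge_set_def)
  then show "\<exists>u v. u \<in> verts G \<and> v \<in> verts G \<and> u \<noteq> v \<and> e = {u, v}"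
    using no_loops[of a] by (intro exI[of _ "tail G a"] exI[of _ "head G a"]) simp
qed simp

text \<open>On arcs with tail \<open>v\<close> the map to end sets is injective, as there are no
  parallel arcs. It reaches every edge at \<open>v\<close>, since an arc entering \<open>v\<close>
  can be replaced by its reverse.\<close>

lemma vertex_degree_edge_subgraph:
  assumes F: "F \<subseteq> edge_set G"
  shows "int (vertex_degree (edge_subgraph G F) v) = edge_deg F v"
proof -
  let ?A = "{e \<in> arcs G. {tail G e, head G e} \<in> F \<and> tail G e = v}"
    and ?f = "\<lambda>e. {tail G e, head G e}"
  have inj: "inj_on ?f ?A"
    by (rule inj_onI) (auto simp: doubleton_eq_iff arc_to_ends_def intro!: no_multi_arcs)
  have image: "?f ` ?A = {e \<in> F. v \<in> e}"
  proof (intro equalityI subsetI)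
    fix e assume e: "e \<in> {e \<in> F. v \<in> e}"
    then obtain a where a: "a \<in> arcs G" "e = ?f a" using F by (auto simp: edge_set_def)
    obtain a' where a': "a' \<in> arcs G" "tail G a' = head G a" "head G a' = tail G a"
      using reverse_arc[OF a(1)] .
    show "e \<in> ?f ` ?A"
    proof (cases "tail G a = v")
      case True
      then show ?thesis using a e by (intro image_eqI[of _ _ a]) auto
    next
      case False
      then show ?thesis using a a' e by (intro image_eqI[of _ _ a']) (auto simp: insert_commute)
    qed
  qed auto
  have "card ?A = card {e \<in> F. v \<in> e}" using card_image[OF inj] unfolding image by (rule sym)
  moreover have "out_arcs (edge_subgraph G F) v = ?A"
    by (auto simp: out_arcs_def edge_subgraph_def)
  ultimately show ?thesis by (simp add: vertex_degree_def out_degree_def edge_deg_def)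
qed

lemma edge_subgraph_edge_set: "edge_subgraph G (edge_set G) = G"
proof -
  have "{e \<in> arcs G. {tail G e, head G e} \<in> edge_set G} = arcs G" by (auto simp: edge_set_def)
  then show ?thesis by (simp add: edge_subgraph_def)
qed

lemma vertex_degree_eq: "int (vertex_degree G v) = edge_deg (edge_set G) v"
  using vertex_degree_edge_subgraph[of "edge_set G" v] by (simp add: edge_subgraph_edge_set)

lemma graph_edge_subgraph: "graph (edge_subgraph G F)"
proof -
  let ?H = "edge_subgraph G F"
  have sub: "e \<in> arcs G" "{tail G e, head G e} \<in> F" if "e \<in> arcs ?H" for e
    using that by (auto simp: edge_subgraph_def)
  have [simp]: "tail ?H = tail G" "head ?H = head G" "verts ?H = verts G"
    by (simp_all add: edge_subgraph_def)
  have fin: "finite (arcs ?H)" by (simp add: edge_subgraph_def)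
  have "symmetric ?H"
    unfolding symmetric_conv
  proof
    fix e assume e: "e \<in> arcs ?H"
    obtain e' where "e' \<in> arcs G" "tail G e' = head G e" "head G e' = tail G e"
      using reverse_arc[OF sub(1)[OF e]] .
    then show "\<exists>e2\<in>arcs ?H. tail ?H e = head ?H e2 \<and> head ?H e = tail ?H e2"
      using sub(2)[OF e] by (intro bexI[of _ e']) (auto simp: edge_subgraph_def insert_commute)
  qed
  then show ?thesis
    using fin sub(1) no_loops no_multi_arcs
    by unfold_locales (simp_all add: arc_to_ends_def)
qed

lemma spanning_edge_subgraph: "spanning (edge_subgraph G F) G"
proof -
  have "wf_digraph (edge_subgraph G F)"
    using graph_edge_subgraph[of F]
    by (simp add: graph_def digraph_def fin_digraph_def)
  then show ?thesis
    using wf_digraph by (auto simp: spanning_def subgraph_def compatible_def edge_subgraph_def)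
qed

text \<open>Supplies the connectedness assumption of \<open>ex_parity_factor\<close>: by symmetry of
  the arcs, reachability in \<open>mk_symmetric G\<close> is reachability in \<open>G\<close>, along
  which \<open>C\<close> is closed.\<close>

lemma closed_set_eq_verts:
  assumes "connected G" "C \<noteq> {}" "C \<subseteq> verts G"
    and closed: "\<And>x y. x \<in> C \<Longrightarrow> x \<rightarrow> y \<Longrightarrow> y \<in> C"
  shows "C = verts G"
proof
  obtain x where x: "x \<in> C" using assms by blast
  show "verts G \<subseteq> C"
  proof
    fix y assume "y \<in> verts G"
    then have "x \<rightarrow>\<^sup>*\<^bsub>mk_symmetric G\<^esub> y"
      using assms(1,3) x unfolding connected_def by (auto elim!: strongly_connectedE)
    then have "x \<rightarrow>\<^sup>* y" using reachable_mk_symmetric_eq[OF sym_arcs] by blast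
    then show "y \<in> C" by (induction rule: reachable_induct) (use x closed in auto)
  qed
qed fact

end

theorem theorem1p4:
  fixes a b n :: nat and G :: "('a, 'b) pre_digraph"
  assumes "0 < a" and "0 < b" and "0 < n"
    and "[a = b] (mod 2)" and "a < b"
    and "[n * a = 0] (mod 2)"
    and "n \<ge> 3 * (b + 1) * (a + b)"
    and "graph G" and "Digraph_Component.connected G"
    and "card (verts G) = n"
    and "real (min_degree G) \<ge> (real b ^ 2 - real b) / real a"
    and "\<forall>u\<in>verts G. \<forall>v\<in>verts G. u \<noteq> v \<and> \<not> (u \<rightarrow>\<^bsub>G\<^esub> v) \<longrightarrow>
           real (max (vertex_degree G u) (vertex_degree G v))
             \<ge> real b * real n / (real a + real b)"
  shows "has_all_parity_factors a b G"
  unfolding has_all_parity_factors_def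
proof (intro allI impI)
  fix h assume h: "\<forall>v\<in>verts G. a \<le> h v \<and> h v \<le> b \<and> [h v = a] (mod 2)"
  interpret graph G by fact
  interpret S: set_graph "verts G" "edge_set G" by (rule set_graph_edge_set)
  have deg: "real_of_int (edge_deg (edge_set G) v) = real (vertex_degree G v)" for v
    by (simp flip: vertex_degree_eq)
  have "\<exists>F\<subseteq>edge_set G. \<forall>v\<in>verts G. edge_deg F v = int (h v)"
  proof (rule S.ex_parity_factor[of a b])
    show "1 \<le> a" using assms(1) by simp
    have "even a \<longleftrightarrow> even b" using assms(4) by (simp add: cong_def even_iff_mod_2_eq_zero)
    then have "b \<noteq> a + 1" by auto
    then show "a + 2 \<le> b" using assms(5) by linarith
    show "3 * (b + 1) * (a + b) \<le> card (verts G)" using assms(7,10) by simp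
    show "int a \<le> int (h v) \<and> int (h v) \<le> int b" if "v \<in> verts G" for v
      using h that by auto
    have "[(\<Sum>v\<in>verts G. h v) = (\<Sum>v\<in>verts G. a)] (mod 2)"
      by (rule cong_sum) (use h in auto)
    then have "[(\<Sum>v\<in>verts G. h v) = 0] (mod 2)"
      using assms(6,10) cong_trans by auto
    then have "even (\<Sum>v\<in>verts G. h v)" by (simp add: cong_def even_iff_mod_2_eq_zero)
    then show "even (\<Sum>v\<in>verts G. int (h v))" by (simp flip: of_nat_sum)
    show "C = verts G" if "C \<noteq> {}" "C \<subseteq> verts G"
      and "\<And>x y. x \<in> C \<Longrightarrow> y \<in> verts G \<Longrightarrow> {x, y} \<in> edge_set G \<Longrightarrow> y \<in> C" for C
      using that(3) adj_in_verts by (intro closed_set_eq_verts[OF assms(9) that(1,2)]) (simp add: in_edge_set_iff)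
    show "(real b)\<^sup>2 - real b \<le> real a * edge_deg (edge_set G) v" if "v \<in> verts G" for v
    proof -
      have "min_degree G \<le> vertex_degree G v"
        using that by (simp add: min_degree_def)
      then have "((real b)\<^sup>2 - real b) / real a \<le> real (vertex_degree G v)"
        using assms(11) by (meson of_nat_le_iff order_trans)
      then show ?thesis using assms(1) by (simp add: deg pos_divide_le_eq mult.commute)
    qed
    show "{u, v} \<in> edge_set G"
      if "u \<in> verts G" "v \<in> verts G" "u \<noteq> v"
        "edge_deg (edge_set G) u < real b * real (card (verts G)) / (real a + real b)"
        "edge_deg (edge_set G) v < real b * real (card (verts G)) / (real a + real b)" for u v
    proof (rule ccontr)
      assume "{u, v} \<notin> edge_set G"
      then have "real b * real n / (real a + real b)
          \<le> real (max (vertex_degree G u) (vertex_degree G v))"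
        using assms(12) that(1-3) by (simp add: in_edge_set_iff)
      then show False using that(4,5) unfolding deg assms(10) by (simp add: max_def split: if_splits)
    qed
  qed
  then obtain F where F: "F \<subseteq> edge_set G" "\<And>v. v \<in> verts G \<Longrightarrow> edge_deg F v = int (h v)" by blast
  have "vertex_degree (edge_subgraph G F) v = h v" if "v \<in> verts G" for v
    using vertex_degree_edge_subgraph[OF F(1), of v] F(2)[OF that] by simp
  then have "is_factor G h (edge_subgraph G F)"
    unfolding is_factor_def using graph_edge_subgraph spanning_edge_subgraph by blast
  then show "\<exists>F. is_factor G h F" by blast
qed

end
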